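(* Let $A$ be a random variable with values in $\{0,1\}$, $X$ a random variable with values in a set $\mathcal{X}$, and $Y$ a random variable with values in a finite set $\mathcal{Y}$, jointly distributed with $(X,A)$. Let $h:\Delta_{\mathcal{Y}}\to\mathbb{R}$ be continuous and concave. Let $Z$ be any representation of $(X,A)$ on a set $\mathcal{Z}$. Then there exists an invertible representation $Z'$ of $(X,A)$, on some set $\mathcal{Z}'$, such that $$\mathbb{E}_{z'\sim Z'}\, h(\mathbb{P}(Y\mid Z'=z'))\le \mathbb{E}_{z\sim Z}\, h(\mathbb{P}(Y\mid Z=z))\quad\text{and}\quad D_{TV}(Z')=D_{TV}(Z).$$
   Context: $\Delta_{\mathcal{Y}}$ is the set of probability distributions on the finite set $\mathcal{Y}$. A representation $Z$ of $(X,A)$ on a set $\mathcal{Z}$ is a random variable with values in $\mathcal{Z}$, specified through a conditional distribution $\mathbb{P}(Z\mid X,A)$, and such that conditioned on $(X,A)$, $Z$ is independent of the other variables of the problem; in particular $Z\perp Y\mid (X,A)$. $\mathbb{P}(Y\mid Z=z)\in\Delta_{\mathcal{Y}}$ denotes the conditional distribution of $Y$ given $Z=z$. A representation $Z$ on $\mathcal{Z}$ is invertible if for every $z\in\mathcal{Z}$ and every $a\in\{0,1\}$ there is at most one $x\in\mathcal{X}$ such that $\mathbb{P}(Z=z\mid X=x,A=a)>0$. For a representation $Z$, $\mu_a=\mathbb{P}(Z=\cdot\mid A=a)$ for $a\in\{0,1\}$ (both values of $A$ have positive probability), and $D_{TV}(Z)=\|\mu_0-\mu_1\|_{TV}$,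 where the total variation distance is normalized as half the $L_1$ distance: for $\mu,\nu$ with densities $f_\mu,f_\nu$ with respect to a common reference measure, $\|\mu-\nu\|_{TV}=\frac12\int|f_\mu-f_\nu|$; on a discrete set, $\|\mu-\nu\|_{TV}=\frac12\sum_z|\mu(z)-\nu(z)|$. *)

theory Defs
  imports "HOL-Probability.Probability"
begin

definition prob_simplex :: "(real ^ 'y::finite) set" where
  "prob_simplex = {p. (\<forall>y. 0 \<le> p $ y) \<and> (\<Sum>y\<in>UNIV. p $ y) = 1}"


subsection \<open>Representations\<close>

text \<open>The values 0 and 1 of \<^term>\<open>A\<close> are encoded as \<^term>\<open>False\<close> and \<^term>\<open>True\<close>.
  A representation is given by a Markov kernel, \<^term>\<open>K (x, a)\<close> being the law of \<^term>\<open>Z\<close>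
  given \<^term>\<open>X = x\<close> and \<^term>\<open>A = a\<close>. Measurability of singletons is what
  makes the probability of \<^term>\<open>Z = z\<close> meaningful; without it the condition in
  \<open>invertible_rep\<close> could hold merely because non-measurable sets get measure 0 in HOL.\<close>

definition representation :: "'x measure \<Rightarrow> 'z measure \<Rightarrow> ('x \<times> bool \<Rightarrow> 'z measure) \<Rightarrow> bool" where
  "representation MX MZ K \<longleftrightarrow>
     K \<in> MX \<Otimes>\<^sub>M count_space UNIV \<rightarrow>\<^sub>M prob_algebra MZ \<and>
     (\<forall>z\<in>space MZ. {z} \<in> sets MZ)"

definition invertible_rep :: "'x measure \<Rightarrow> 'z measure \<Rightarrow> ('x \<times> bool \<Rightarrow> 'z measure) \<Rightarrow> bool" where
  "invertible_rep MX MZ K \<longleftrightarrow>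
     (\<forall>z\<in>space MZ. \<forall>a. \<exists>\<^sub>\<le>\<^sub>1x. x \<in> space MX \<and> measure (K (x, a)) {z} > 0)"

text \<open>The original probability space enlarged by \<^term>\<open>Z\<close>: an outcome is a pair \<open>(\<omega>, z)\<close>
  where \<open>\<omega>\<close> is drawn from \<^term>\<open>M\<close> and then \<open>z\<close> from \<open>K (X \<omega>, A \<omega>)\<close>. The law of \<open>z\<close> depends
  on \<open>\<omega>\<close> through \<open>(X \<omega>, A \<omega>)\<close> only, so that \<^term>\<open>Z = snd\<close> is independent, given \<open>(X, A)\<close>,
  of every random variable on \<^term>\<open>M\<close>.\<close>

definition rep_space ::
  "'m measure \<Rightarrow> ('m \<Rightarrow> 'x) \<Rightarrow> ('m \<Rightarrow> bool) \<Rightarrow> 'z measure \<Rightarrow> ('x \<times> bool \<Rightarrow> 'z measure) \<Rightarrow> ('m \<times> 'z) measure"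
where
  "rep_space M X A MZ K = M \<bind> (\<lambda>\<omega>. distr (K (X \<omega>, A \<omega>)) (M \<Otimes>\<^sub>M MZ) (\<lambda>z. (\<omega>, z)))"

lemma prob_space_rep_space:
  assumes M: "prob_space M" and X: "X \<in> M \<rightarrow>\<^sub>M MX" and A: "A \<in> M \<rightarrow>\<^sub>M count_space UNIV"
    and K: "representation MX MZ K"
  shows "prob_space (rep_space M X A MZ K)" "sets (rep_space M X A MZ K) = sets (M \<Otimes>\<^sub>M MZ)"
proof -
  have [measurable]: "K \<in> MX \<Otimes>\<^sub>M count_space UNIV \<rightarrow>\<^sub>M prob_algebra MZ"
    using K by (simp add: representation_def)
  note [measurable] = X A
  have k: "(\<lambda>\<omega>. distr (K (X \<omega>, A \<omega>)) (M \<Otimes>\<^sub>M MZ) (\<lambda>z. (\<omega>, z))) \<in> M \<rightarrow>\<^sub>M prob_algebra (M \<Otimes>\<^sub>M MZ)"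
    by measurable
  have M': "M \<in> space (prob_algebra M)"
    using M by (simp add: space_prob_algebra)
  show "prob_space (rep_space M X A MZ K)"
    unfolding rep_space_def by (rule prob_space_bind'[OF M' k])
  show "sets (rep_space M X A MZ K) = sets (M \<Otimes>\<^sub>M MZ)"
    unfolding rep_space_def by (rule sets_bind'[OF M' k])
qed


subsection \<open>Conditional distribution of Y given Z\<close>

definition is_cond_dist ::
  "'e measure \<Rightarrow> ('e \<Rightarrow> 'y::finite) \<Rightarrow> 'z measure \<Rightarrow> ('e \<Rightarrow> 'z) \<Rightarrow> ('z \<Rightarrow> real ^ 'y) \<Rightarrow> bool"
where
  "is_cond_dist E Y MZ Z p \<longleftrightarrow>
     p \<in> borel_measurable MZ \<and> (\<forall>z\<in>space MZ. p z \<in> prob_simplex) \<and>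
     (\<forall>y. \<forall>B\<in>sets MZ. measure E {w \<in> space E. Y w = y \<and> Z w \<in> B} =
        set_lebesgue_integral (distr E MZ Z) B (\<lambda>z. p z $ y))"

text \<open>Some version of \<open>z \<mapsto> P(Y | Z = z)\<close>. Versions exist (\<open>is_cond_dist_cond_dist\<close>)
  and agree almost everywhere (\<open>is_cond_dist_unique\<close>), so the choice does not affect integrals against the
  law of \<^term>\<open>Z\<close>.\<close>

definition cond_dist ::
  "'e measure \<Rightarrow> ('e \<Rightarrow> 'y::finite) \<Rightarrow> 'z measure \<Rightarrow> ('e \<Rightarrow> 'z) \<Rightarrow> 'z \<Rightarrow> real ^ 'y" where
  "cond_dist E Y MZ Z = (SOME p. is_cond_dist E Y MZ Z p)"

lemma is_cond_dist_unique:
  fixes Y :: "'e \<Rightarrow> 'y::finite"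
  assumes E: "prob_space E" and Z: "Z \<in> E \<rightarrow>\<^sub>M MZ"
    and p: "is_cond_dist E Y MZ Z p" and q: "is_cond_dist E Y MZ Z q"
  shows "AE z in distr E MZ Z. p z = q z"
proof -
  interpret prob_space E by fact
  interpret L: prob_space "distr E MZ Z" by (rule prob_space_distr[OF Z])
  have bnd: "norm (v $ y) \<le> 1" if "v \<in> prob_simplex" for v :: "real ^ 'y" and y
  proof -
    have "v $ y \<le> (\<Sum>y\<in>UNIV. v $ y)"
      using that by (intro member_le_sum) (auto simp: prob_simplex_def)
    then show ?thesis using that by (simp add: prob_simplex_def)
  qed
  have int: "integrable (distr E MZ Z) (\<lambda>z. r z $ y)" if "is_cond_dist E Y MZ Z r" for r y
  proof (rule L.integrable_const_bound[where B=1])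
    show "AE z in distr E MZ Z. norm (r z $ y) \<le> 1"
      using that bnd by (intro AE_I2) (auto simp: is_cond_dist_def)
    have "r \<in> borel_measurable MZ" using that by (simp add: is_cond_dist_def)
    then show "(\<lambda>z. r z $ y) \<in> borel_measurable (distr E MZ Z)"
      by (simp add: cart_eq_inner_axis)
  qed
  have "AE z in distr E MZ Z. p z $ y = q z $ y" for y
  proof (rule density_unique_real[OF int[OF p] int[OF q]])
    fix B assume "B \<in> sets (distr E MZ Z)"
    then show "set_lebesgue_integral (distr E MZ Z) B (\<lambda>z. p z $ y)
        = set_lebesgue_integral (distr E MZ Z) B (\<lambda>z. q z $ y)"
      using p q by (auto simp: is_cond_dist_def)
  qed
  then have "AE z in distr E MZ Z. \<forall>y\<in>UNIV. p z $ y = q z $ y"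
    by (intro AE_finite_allI) auto
  then show ?thesis by eventually_elim (simp add: vec_eq_iff)
qed

lemma is_cond_dist_cond_dist:
  fixes Y :: "'e \<Rightarrow> 'y::finite"
  assumes E: "prob_space E" and Y: "Y \<in> E \<rightarrow>\<^sub>M count_space UNIV" and Z: "Z \<in> E \<rightarrow>\<^sub>M MZ"
  shows "is_cond_dist E Y MZ Z (cond_dist E Y MZ Z)"
proof -
  interpret prob_space E by fact
  define L where "L = distr E MZ Z"
  interpret L: prob_space L unfolding L_def by (rule prob_space_distr[OF Z])
  note [measurable] = Y Z
  have sL[measurable_cong]: "sets L = sets MZ" and spL: "space L = space MZ" by (simp_all add: L_def)
  define N where "N y = distr (density E (indicator {w \<in> space E. Y w = y})) MZ Z" for y
  have [measurable]: "{w \<in> space E. Y w = y} \<in> sets E" for y by measurable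
  have emN: "emeasure (N y) B = emeasure E {w \<in> space E. Y w = y \<and> Z w \<in> B}"
    if [measurable]: "B \<in> sets MZ" for y B
  proof -
    have "emeasure (N y) B = emeasure (density E (indicator {w \<in> space E. Y w = y})) (Z -` B \<inter> space E)"
      unfolding N_def by (subst emeasure_distr) auto
    also have "\<dots> = (\<integral>\<^sup>+w. indicator {w \<in> space E. Y w = y} w * indicator (Z -` B \<inter> space E) w \<partial>E)"
      by (subst emeasure_density) auto
    also have "\<dots> = (\<integral>\<^sup>+w. indicator {w \<in> space E. Y w = y \<and> Z w \<in> B} w \<partial>E)"
      by (intro nn_integral_cong) (auto split: split_indicator)
    also have "\<dots> = emeasure E {w \<in> space E. Y w = y \<and> Z w \<in> B}"
      by (intro nn_integral_indicator) measurable
    finally show ?thesis .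
  qed
  have sN: "sets (N y) = sets L" for y by (simp add: N_def L_def)
  have emL: "emeasure L B = emeasure E {w \<in> space E. Z w \<in> B}" if "B \<in> sets MZ" for B
  proof -
    have "Z -` B \<inter> space E = {w \<in> space E. Z w \<in> B}" by auto
    then show ?thesis using that unfolding L_def by (subst emeasure_distr) auto
  qed
  have NL: "emeasure (N y) B \<le> emeasure L B" if [measurable]: "B \<in> sets MZ" for y B
    unfolding emN[OF that] emL[OF that] by (rule emeasure_mono) auto
  have ac: "absolutely_continuous L (N y)" for y
    unfolding absolutely_continuous_def
  proof
    fix B assume B: "B \<in> null_sets L"
    then have "B \<in> sets MZ" "emeasure L B = 0" by (auto simp: sL)
    with NL[of B y] have "emeasure (N y) B = 0" by simp
    with B sN[of y] show "B \<in> null_sets (N y)" by (simp add: null_sets_def)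
  qed
  have fN: "finite_measure (N y)" for y
  proof (rule finite_measureI)
    have "emeasure (N y) (space MZ) \<le> emeasure L (space MZ)" by (rule NL) simp
    also have "\<dots> < \<infinity>" using L.emeasure_space_1 by (simp add: spL)
    finally show "emeasure (N y) (space (N y)) \<noteq> \<infinity>" by (simp add: N_def)
  qed
  have sfN: "sigma_finite_measure (N y)" for y
    using fN[of y] by (simp add: finite_measure_def)
  define g where "g y z = enn2real (RN_deriv L (N y) z)" for y z
  have g_meas[measurable]: "g y \<in> borel_measurable MZ" for y
  proof -
    have "g y \<in> borel_measurable L" unfolding g_def by measurable
    then show ?thesis by (simp add: measurable_cong_sets[OF sL refl])
  qed
  have g_nn: "0 \<le> g y z" for y z by (simp add: g_def)
  have g_indint: "integrable L (\<lambda>z. g y z * indicator B z)"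
    and g_int: "measure (N y) B = (\<integral>z. g y z * indicator B z \<partial>L)" if B: "B \<in> sets MZ" for y B
  proof -
    have BL: "B \<in> sets L" "B \<in> sets (N y)" using B by (simp_all add: sL sN)
    have "integrable (N y) (indicator B :: _ \<Rightarrow> real)"
      using BL fN[of y] by (intro integrable_real_indicator) (auto simp: finite_measure.emeasure_finite less_top[symmetric])
    then show "integrable L (\<lambda>z. g y z * indicator B z)"
      using L.RN_deriv_integrable[OF sfN ac sN, of "indicator B :: _ \<Rightarrow> real" y] BL
      unfolding g_def by simp
    have "measure (N y) B = integral\<^sup>L (N y) (indicator B)"
      using BL sets.sets_into_space[OF BL(2)] by (simp add: Int_absorb2)
    also have "\<dots> = (\<integral>z. g y z * indicator B z \<partial>L)"
      using L.RN_deriv_integral[OF sfN ac sN, of "indicator B :: _ \<Rightarrow> real" y] BL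
      unfolding g_def by simp
    finally show "measure (N y) B = (\<integral>z. g y z * indicator B z \<partial>L)" .
  qed
  have mN: "measure (N y) B = measure E {w \<in> space E. Y w = y \<and> Z w \<in> B}" if "B \<in> sets MZ" for y B
    using emN[OF that] by (simp add: measure_def)
  have int_g: "integrable L (g y)" for y
  proof -
    have "integrable L (\<lambda>z. g y z * indicator (space MZ) z)" by (rule g_indint) simp
    then show ?thesis by (rule Bochner_Integration.integrable_cong[THEN iffD1, rotated -1]) (auto simp: spL)
  qed
  have sum1: "AE z in L. (\<Sum>y\<in>UNIV. g y z) = 1"
  proof (rule density_unique_real)
    show "integrable L (\<lambda>z. \<Sum>y\<in>UNIV. g y z)" using int_g by auto
    show "integrable L (\<lambda>z. 1 :: real)" by simp
    fix B assume "B \<in> sets L"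
    then have B[measurable]: "B \<in> sets MZ" by (simp add: sL)
    have "set_lebesgue_integral L B (\<lambda>z. \<Sum>y\<in>UNIV. g y z) = (\<integral>z. (\<Sum>y\<in>UNIV. g y z * indicator B z) \<partial>L)"
      unfolding set_lebesgue_integral_def by (simp add: sum_distrib_left mult.commute)
    also have "\<dots> = (\<Sum>y\<in>UNIV. measure (N y) B)"
      using g_indint[OF B] g_int[OF B] by (subst Bochner_Integration.integral_sum) auto
    also have "\<dots> = (\<Sum>y\<in>UNIV. measure E {w \<in> space E. Y w = y \<and> Z w \<in> B})"
      using mN[OF B] by simp
    also have "\<dots> = measure E (\<Union>y. {w \<in> space E. Y w = y \<and> Z w \<in> B})"
      by (rule finite_measure_finite_Union[symmetric]) (auto simp: disjoint_family_on_def)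
    also have "(\<Union>y. {w \<in> space E. Y w = y \<and> Z w \<in> B}) = {w \<in> space E. Z w \<in> B}" by auto
    also have "measure E \<dots> = measure L B" using emL[OF B] by (simp add: measure_def)
    also have "\<dots> = set_lebesgue_integral L B (\<lambda>z. 1)"
      using sets.sets_into_space[OF B] unfolding set_lebesgue_integral_def by (simp add: spL Int_absorb2)
    finally show "set_lebesgue_integral L B (\<lambda>z. \<Sum>y\<in>UNIV. g y z) = set_lebesgue_integral L B (\<lambda>z. 1)" .
  qed
  define p :: "_ \<Rightarrow> real ^ 'y" where
    "p z = (\<chi> y. if (\<Sum>y\<in>UNIV. g y z) = 1 then g y z else 1 / CARD('y))" for z
  have "is_cond_dist E Y MZ Z p"
    unfolding is_cond_dist_def
  proof (intro conjI ballI allI)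
    have "(\<lambda>z. p z $ y) \<in> borel_measurable MZ" for y
      unfolding p_def vec_lambda_beta by measurable
    then show "p \<in> borel_measurable MZ"
      by (subst borel_measurable_euclidean_space) (auto simp: Basis_vec_def inner_axis)
    show "p z \<in> prob_simplex" for z
      using g_nn by (cases "(\<Sum>y\<in>UNIV. g y z) = 1") (auto simp: p_def prob_simplex_def)
    fix y B assume B[measurable]: "B \<in> sets MZ"
    have pm[measurable]: "(\<lambda>z. p z $ y) \<in> borel_measurable MZ"
      unfolding p_def vec_lambda_beta by measurable
    have "measure E {w \<in> space E. Y w = y \<and> Z w \<in> B} = (\<integral>z. g y z * indicator B z \<partial>L)"
      using mN[OF B] g_int[OF B] by simp
    also have "\<dots> = (\<integral>z. indicator B z *\<^sub>R p z $ y \<partial>L)"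
    proof (rule integral_cong_AE)
      show "AE z in L. g y z * indicator B z = indicator B z *\<^sub>R p z $ y"
        using sum1 by eventually_elim (simp add: p_def)
    qed measurable
    finally show "measure E {w \<in> space E. Y w = y \<and> Z w \<in> B} =
        set_lebesgue_integral (distr E MZ Z) B (\<lambda>z. p z $ y)"
      unfolding set_lebesgue_integral_def L_def .
  qed
  then show ?thesis unfolding cond_dist_def by (rule someI[of "is_cond_dist E Y MZ Z"])
qed


subsection \<open>Total variation distance\<close>

text \<open>The reference measure is \<open>\<mu> + \<nu>\<close>; by \<open>tv_dist_density\<close> any other measure dominating both, such as
  the counting measure on a discrete set, gives the same value.\<close>

definition add_measure :: "'a measure \<Rightarrow> 'a measure \<Rightarrow> 'a measure" where
  "add_measure \<mu> \<nu> = measure_of (space \<mu>) (sets \<mu>) (\<lambda>B. emeasure \<mu> B + emeasure \<nu> B)"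

definition tv_dist :: "'a measure \<Rightarrow> 'a measure \<Rightarrow> real" where
  "tv_dist \<mu> \<nu> = (let \<rho> = add_measure \<mu> \<nu> in
     1 / 2 * (\<integral>z. \<bar>enn2real (RN_deriv \<rho> \<mu> z) - enn2real (RN_deriv \<rho> \<nu> z)\<bar> \<partial>\<rho>))"

lemma emeasure_add_measure:
  assumes "sets \<nu> = sets \<mu>" "B \<in> sets \<mu>"
  shows "emeasure (add_measure \<mu> \<nu>) B = emeasure \<mu> B + emeasure \<nu> B"
  unfolding add_measure_def
proof (rule emeasure_measure_of_sigma[OF sets.sigma_algebra_axioms _ _ assms(2)])
  show "positive (sets \<mu>) (\<lambda>B. emeasure \<mu> B + emeasure \<nu> B)" by (simp add: positive_def)
  show "countably_additive (sets \<mu>) (\<lambda>B. emeasure \<mu> B + emeasure \<nu> B)"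
  proof (rule countably_additiveI)
    fix F :: "nat \<Rightarrow> 'a set" assume F: "range F \<subseteq> sets \<mu>" "disjoint_family F"
    have "(\<Sum>i. emeasure \<mu> (F i) + emeasure \<nu> (F i)) = (\<Sum>i. emeasure \<mu> (F i)) + (\<Sum>i. emeasure \<nu> (F i))"
      by (rule suminf_add[symmetric]) auto
    then show "(\<Sum>i. emeasure \<mu> (F i) + emeasure \<nu> (F i)) = emeasure \<mu> (\<Union>(range F)) + emeasure \<nu> (\<Union>(range F))"
      using F assms(1) by (simp add: suminf_emeasure)
  qed
qed

lemma tv_dist_density:
  assumes f[measurable]: "f \<in> borel_measurable \<rho>" and g[measurable]: "g \<in> borel_measurable \<rho>"
    and nn: "\<And>z. 0 \<le> f z" "\<And>z. 0 \<le> g z"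
    and \<mu>: "\<mu> = density \<rho> f" "prob_space \<mu>" and \<nu>: "\<nu> = density \<rho> g" "prob_space \<nu>"
  shows "tv_dist \<mu> \<nu> = 1 / 2 * (\<integral>z. \<bar>f z - g z\<bar> \<partial>\<rho>)"
proof -
  define S where "S = add_measure \<mu> \<nu>"
  define s where "s z = f z + g z" for z
  have [measurable]: "s \<in> borel_measurable \<rho>" unfolding s_def by measurable
  have snn: "0 \<le> s z" for z using nn by (simp add: s_def)
  have sets: "sets \<mu> = sets \<rho>" "sets \<nu> = sets \<rho>" "space \<mu> = space \<rho>" by (simp_all add: \<mu>(1) \<nu>(1))
  have setsS: "sets S = sets \<rho>" "space S = space \<rho>"
    by (simp_all add: S_def add_measure_def sets)
  have S: "S = density \<rho> s"
  proof (rule measure_eqI)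
    fix B assume "B \<in> sets S"
    then have [measurable]: "B \<in> sets \<rho>" by (simp add: setsS)
    have "emeasure S B = emeasure \<mu> B + emeasure \<nu> B"
      unfolding S_def by (rule emeasure_add_measure) (simp_all add: sets)
    also have "\<dots> = (\<integral>\<^sup>+z. ennreal (f z) * indicator B z + ennreal (g z) * indicator B z \<partial>\<rho>)"
      unfolding \<mu>(1) \<nu>(1) by (subst nn_integral_add) (auto simp: emeasure_density)
    also have "\<dots> = (\<integral>\<^sup>+z. ennreal (s z) * indicator B z \<partial>\<rho>)"
      by (intro nn_integral_cong) (simp add: s_def nn ennreal_plus distrib_right)
    also have "\<dots> = emeasure (density \<rho> s) B" by (simp add: emeasure_density)
    finally show "emeasure S B = emeasure (density \<rho> s) B" .
  qed (simp add: setsS)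
  interpret S: finite_measure S
  proof (rule finite_measureI)
    interpret \<mu>: prob_space \<mu> by (rule \<mu>(2))
    interpret \<nu>: prob_space \<nu> by (rule \<nu>(2))
    have "emeasure S (space \<mu>) = emeasure \<mu> (space \<mu>) + emeasure \<nu> (space \<mu>)"
      unfolding S_def by (rule emeasure_add_measure) (simp_all add: sets)
    then show "emeasure S (space S) \<noteq> \<infinity>"
      by (simp add: setsS sets(3)[symmetric] ennreal_add_eq_top)
  qed
  have rn: "AE z in S. ennreal (k z / s z) = RN_deriv S (density \<rho> k) z"
    if [measurable]: "k \<in> borel_measurable \<rho>" and k: "\<And>z. 0 \<le> k z" "\<And>z. k z \<le> s z" for k
  proof (rule S.RN_deriv_unique)
    show "(\<lambda>z. ennreal (k z / s z)) \<in> borel_measurable S"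
      unfolding S by measurable
    have eq: "ennreal (s z) * ennreal (k z / s z) = ennreal (k z)" for z
    proof (cases "s z = 0")
      case True
      then show ?thesis using k[of z] by simp
    next
      case False
      then show ?thesis using snn[of z] k(1)[of z] by (simp flip: ennreal_mult)
    qed
    show "density S (\<lambda>z. ennreal (k z / s z)) = density \<rho> k"
      unfolding S by (subst density_density_eq) (auto simp: eq)
  qed
  have kd: "AE z in S. enn2real (RN_deriv S (density \<rho> k) z) = k z / s z"
    if [measurable]: "k \<in> borel_measurable \<rho>" and k: "\<And>z. 0 \<le> k z" "\<And>z. k z \<le> s z" for k
    using rn[OF that]
  proof eventually_elim
    case (elim z)
    have "0 \<le> k z / s z" using k(1)[of z] snn[of z] by simp
    with elim[symmetric] show ?case by simp
  qed
  have "(\<integral>z. \<bar>enn2real (RN_deriv S \<mu> z) - enn2real (RN_deriv S \<nu> z)\<bar> \<partial>S)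
      = (\<integral>z. \<bar>f z / s z - g z / s z\<bar> \<partial>S)"
  proof (rule integral_cong_AE)
    show "AE z in S. \<bar>enn2real (RN_deriv S \<mu> z) - enn2real (RN_deriv S \<nu> z)\<bar> = \<bar>f z / s z - g z / s z\<bar>"
      proof -
      have fs: "AE z in S. enn2real (RN_deriv S \<mu> z) = f z / s z"
        unfolding \<mu>(1) by (rule kd[OF f]) (auto simp: nn s_def)
      have gs: "AE z in S. enn2real (RN_deriv S \<nu> z) = g z / s z"
        unfolding \<nu>(1) by (rule kd[OF g]) (auto simp: nn s_def)
      from fs gs show ?thesis by eventually_elim simp
    qed
    show "(\<lambda>z. \<bar>f z / s z - g z / s z\<bar>) \<in> borel_measurable S" unfolding S by measurable
  qed measurable
  also have "\<dots> = (\<integral>z. s z *\<^sub>R \<bar>f z / s z - g z / s z\<bar> \<partial>\<rho>)"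
    unfolding S by (rule integral_density) (auto simp: snn)
  also have "\<dots> = (\<integral>z. \<bar>f z - g z\<bar> \<partial>\<rho>)"
  proof (rule Bochner_Integration.integral_cong)
    fix z
    show "s z *\<^sub>R \<bar>f z / s z - g z / s z\<bar> = \<bar>f z - g z\<bar>"
    proof (cases "s z = 0")
      case True
      with nn[of z] have "f z = 0" "g z = 0" by (auto simp: s_def)
      then show ?thesis by simp
    next
      case False
      with snn[of z] have "0 < s z" by simp
      then show ?thesis by (simp add: diff_divide_distrib[symmetric] abs_divide)
    qed
  qed simp
  finally show ?thesis by (simp add: tv_dist_def Let_def S_def)
qed


subsection \<open>The quantities compared\<close>

definition expected_h ::
  "(real ^ 'y::finite \<Rightarrow> real) \<Rightarrow> 'm measure \<Rightarrow> ('m \<Rightarrow> 'x) \<Rightarrow> ('m \<Rightarrow> bool) \<Rightarrow> ('m \<Rightarrow> 'y) \<Rightarrow>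
    'z measure \<Rightarrow> ('x \<times> bool \<Rightarrow> 'z measure) \<Rightarrow> real"
where
  "expected_h h M X A Y MZ K = (let E = rep_space M X A MZ K in
     \<integral>z. h (cond_dist E (\<lambda>w. Y (fst w)) MZ snd z) \<partial>distr E MZ snd)"

definition law_given ::
  "bool \<Rightarrow> 'm measure \<Rightarrow> ('m \<Rightarrow> 'x) \<Rightarrow> ('m \<Rightarrow> bool) \<Rightarrow> 'z measure \<Rightarrow> ('x \<times> bool \<Rightarrow> 'z measure) \<Rightarrow> 'z measure"
where
  "law_given a M X A MZ K = (let E = rep_space M X A MZ K in
     distr (uniform_measure E {w \<in> space E. A (fst w) = a}) MZ snd)"

definition D_TV ::
  "'m measure \<Rightarrow> ('m \<Rightarrow> 'x) \<Rightarrow> ('m \<Rightarrow> bool) \<Rightarrow> 'z measure \<Rightarrow> ('x \<times> bool \<Rightarrow> 'z measure) \<Rightarrow> real"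
where
  "D_TV M X A MZ K = tv_dist (law_given False M X A MZ K) (law_given True M X A MZ K)"

text \<open>For countable discrete \<open>\<X>\<close> and \<open>\<Z>\<close> the space \<open>\<Z>'\<close> has to be found among the discrete spaces
  as well. Otherwise \<open>invertible_rep\<close> could be met for free, by attaching to \<^term>\<open>Z\<close> an independent
  uniform variable, after which no point \<open>z'\<close> has positive probability.\<close>

definition discrete_space :: "'a measure \<Rightarrow> bool" where
  "discrete_space N \<longleftrightarrow> countable (space N) \<and> sets N = Pow (space N)"

end

theory Submission
  imports Defs
begin

text \<open>When \<open>\<X>\<close> and \<open>\<Z>\<close> are countable, \<open>Z'\<close> is a triple \<open>(Z, X\<^sub>0, X\<^sub>1)\<close>: given \<open>Z = z\<close> and \<open>A = a\<close>, put
  \<open>X\<^sub>a = X\<close> and draw \<open>X\<^sub>1\<^sub>-\<^sub>a\<close> independently from the law of \<open>X\<close> given \<open>Z = z\<close> and \<open>A = 1 - a\<close>. Then \<open>a\<close>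
  and \<open>z'\<close> determine \<open>x\<close>, while under both values of \<open>A\<close> the law of \<open>(X\<^sub>0, X\<^sub>1)\<close> given \<open>Z = z\<close> is the same
  product, so that \<open>Z'\<close> arises from \<open>Z\<close> through one kernel that does not depend on \<open>a\<close>. Since \<open>Z\<close>
  is also a function of \<open>Z'\<close>, such a kernel preserves the total variation distance, and Jensen's
  inequality shows that refining \<open>Z\<close> to \<open>Z'\<close> does not increase the expected concave entropy.
  In the other cases invertibility concerns only atoms, and an independent
  uniform variable takes the place of \<open>(X\<^sub>0, X\<^sub>1)\<close>.\<close>

subsection \<open>Concave entropies and data processing\<close>

text \<open>Compactness serves twice below: it yields a finite family of majorants, and it bounds a
  continuous \<open>h\<close>.\<close>

lemma compact_prob_simplex: "compact (prob_simplex :: (real ^ 'y::finite) set)"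
proof -
  have "prob_simplex = (\<Inter>y. {p :: real ^ 'y. 0 \<le> p $ y}) \<inter> {p. (\<Sum>y\<in>UNIV. p $ y) = 1}"
    by (auto simp: prob_simplex_def)
  moreover have "closed ((\<Inter>y. {p :: real ^ 'y. 0 \<le> p $ y}) \<inter> {p. (\<Sum>y\<in>UNIV. p $ y) = 1})"
    by (intro closed_Int closed_INT ballI closed_Collect_le closed_Collect_eq continuous_intros)
  moreover have "norm p \<le> 1" if "p \<in> prob_simplex" for p :: "real ^ 'y"
    using norm_le_l1_cart[of p] that by (simp add: prob_simplex_def)
  ultimately show ?thesis
    unfolding compact_eq_bounded_closed bounded_iff by metis
qed

text \<open>The epigraph of \<open>- h\<close> over the simplex is closed and convex, so a
  hyperplane separates it strictly from a point slightly below the graph at \<open>q\<close>. The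
  slack \<open>e\<close> matters: at a boundary point of the simplex an exact supporting hyperplane
  may be forced to be vertical, as for Shannon entropy.\<close>

lemma concave_majorant:
  fixes h :: "real ^ 'y::finite \<Rightarrow> real"
  assumes h: "continuous_on prob_simplex h" "concave_on prob_simplex h"
    and q: "q \<in> prob_simplex" and e: "e > 0"
  obtains c where "\<And>p. p \<in> prob_simplex \<Longrightarrow> h p \<le> c \<bullet> p" "c \<bullet> q < h q + e"
proof -
  let ?S = "epigraph prob_simplex (\<lambda>p. - h p)"
  have S: "convex ?S"
    using h(2) by (simp add: convex_epigraph concave_on_def)
  have "?S = {x \<in> prob_simplex \<times> UNIV. - h (fst x) \<le> snd x}"
    by (auto simp: epigraph_def)
  moreover have "closed \<dots>"
  proof (rule continuous_on_closed_Collect_le)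
    show "closed (prob_simplex \<times> UNIV :: ((real ^ 'y) \<times> real) set)"
      by (intro closed_Times compact_imp_closed[OF compact_prob_simplex] closed_UNIV)
    show "continuous_on (prob_simplex \<times> UNIV) (\<lambda>x. - h (fst x))"
      by (intro continuous_intros continuous_on_compose2[OF h(1)]) auto
  qed (intro continuous_intros)
  ultimately have "closed ?S" by simp
  moreover have "(q, - (h q + e)) \<notin> ?S"
    using e by (simp add: mem_epigraph)
  ultimately obtain w b where w: "w \<bullet> (q, - (h q + e)) < b" "\<And>x. x \<in> ?S \<Longrightarrow> w \<bullet> x > b"
    using separating_hyperplane_closed_point[OF S] by metis
  obtain u s where us: "w = (u, s)" by fastforce
  have lower: "u \<bullet> p - s * h p > b" if "p \<in> prob_simplex" for p
    using w(2)[of "(p, - h p)"] that by (simp add: us mem_epigraph)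
  have upper: "u \<bullet> q - s * (h q + e) < b"
    using w(1) by (simp add: us algebra_simps)
  \<comment> \<open>Comparing the two sides of the separation at \<open>q\<close> itself shows that
    the hyperplane is not vertical.\<close>
  have "s * e > 0"
    using lower[OF q] upper by (simp add: algebra_simps)
  then have s: "s > 0" using e by (simp add: zero_less_mult_iff)
  \<comment> \<open>The separation gives an affine bound. Since coordinates sum to 1 on the simplex,
    its constant \<open>- b\<close> is the linear functional given by the vector with all entries
    \<open>- b\<close>, so a purely linear bound results.\<close>
  define c where "c = (1 / s) *\<^sub>R (u - b *\<^sub>R (\<chi> y. 1))"
  have c: "c \<bullet> p = (u \<bullet> p - b) / s" if "p \<in> prob_simplex" for p
  proof -
    have "(\<chi> y. 1) \<bullet> p = 1"
      using that by (simp add: inner_vec_def prob_simplex_def)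
    then show ?thesis by (simp add: c_def inner_diff_left)
  qed
  show thesis
  proof (rule that[of c])
    show "h p \<le> c \<bullet> p" if "p \<in> prob_simplex" for p
      using lower[OF that] s by (simp add: c[OF that] field_simps)
    show "c \<bullet> q < h q + e"
      using upper s by (simp add: c[OF q] field_simps)
  qed
qed

text \<open>For each majorant, the points where it is within \<open>e\<close> of \<open>h\<close>
  form a relatively open set; these sets cover the simplex, and finitely many suffice. Indexing by
  naturals allows a measurable choice by least index, and the finite range gives a uniform bound on
  the functionals.\<close>

lemma concave_majorants:
  fixes h :: "real ^ 'y::finite \<Rightarrow> real"
  assumes h: "continuous_on prob_simplex h" "concave_on prob_simplex h" and e: "e > 0"
  shows "\<exists>c :: nat \<Rightarrow> real ^ 'y. finite (range c) \<and>
    (\<forall>i. \<forall>p\<in>prob_simplex. h p \<le> c i \<bullet> p) \<and> (\<forall>p\<in>prob_simplex. \<exists>i. c i \<bullet> p < h p + e)"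
proof -
  define U where "U c = {p \<in> prob_simplex. c \<bullet> p - h p < e}" for c
  define C where "C = {c. \<forall>p\<in>prob_simplex. h p \<le> c \<bullet> p}"
  have "openin (top_of_set prob_simplex) (U c)" for c
  proof -
    have "U c = prob_simplex \<inter> (\<lambda>p. c \<bullet> p - h p) -` {..<e}"
      by (auto simp: U_def)
    moreover have "openin (top_of_set prob_simplex) \<dots>"
      by (intro continuous_openin_preimage_gen continuous_intros h(1))
    ultimately show ?thesis by simp
  qed
  moreover have "prob_simplex \<subseteq> \<Union>(U ` C)"
  proof
    fix q :: "real ^ 'y" assume q: "q \<in> prob_simplex"
    obtain c where "\<And>p. p \<in> prob_simplex \<Longrightarrow> h p \<le> c \<bullet> p" "c \<bullet> q < h q + e"
      using concave_majorant[OF h q e] by blast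
    with q show "q \<in> \<Union>(U ` C)"
      by (auto simp: C_def U_def algebra_simps intro!: exI[of _ c])
  qed
  ultimately have "\<exists>\<D>\<subseteq>U ` C. finite \<D> \<and> prob_simplex \<subseteq> \<Union>\<D>"
    using compact_prob_simplex[unfolded compact_eq_openin_cover, rule_format, of "U ` C"] by blast
  then obtain \<D> where "\<D> \<subseteq> U ` C" "finite \<D>" "prob_simplex \<subseteq> \<Union>\<D>"
    by blast
  then obtain D where D: "D \<subseteq> C" "finite D" "prob_simplex \<subseteq> \<Union>(U ` D)"
    by (metis finite_subset_image)
  \<comment> \<open>A vertex of the simplex; it shows that the subcover is nonempty, so that
    \<open>from_nat_into\<close> enumerates exactly \<open>D\<close>.\<close>
  have "axis undefined 1 \<in> (prob_simplex :: (real ^ 'y) set)"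
    by (auto simp: prob_simplex_def axis_def)
  with D have "D \<noteq> {}" by auto
  then have range: "range (from_nat_into D) = D"
    using D(2) by (simp add: range_from_nat_into countable_finite)
  show ?thesis
  proof (intro exI[of _ "from_nat_into D"] conjI allI ballI)
    show "finite (range (from_nat_into D))" using range D(2) by simp
    show "h p \<le> from_nat_into D i \<bullet> p" if p: "p \<in> prob_simplex" for i p
      using p D(1) from_nat_into[OF \<open>D \<noteq> {}\<close>, of i] by (auto simp: C_def)
    fix p :: "real ^ 'y" assume p: "p \<in> prob_simplex"
    obtain c where "c \<in> D" "c \<bullet> p < h p + e"
      using p D(3) by (auto simp: U_def algebra_simps)
    with range show "\<exists>i. from_nat_into D i \<bullet> p < h p + e" by (metis imageE)
  qed
qed

section \<open>Conditional distributions as densities\<close>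

lemma measurable_continuous_on_compose:
  assumes "continuous_on S f" "g \<in> borel_measurable N" "\<And>x. x \<in> space N \<Longrightarrow> g x \<in> S"
  shows "(\<lambda>x. f (g x)) \<in> borel_measurable N"
  using assms(2,3)
  by (intro measurable_compose[OF _ borel_measurable_continuous_on_restrict[OF assms(1)]]
      measurable_restrict_space2) auto

lemma norm_prob_simplex_nth_le:
  fixes v :: "real ^ 'y::finite"
  assumes "v \<in> prob_simplex"
  shows "norm (v $ y) \<le> 1"
proof -
  have "v $ y \<le> (\<Sum>y\<in>UNIV. v $ y)"
    using assms by (intro member_le_sum) (auto simp: prob_simplex_def)
  then show ?thesis using assms by (simp add: prob_simplex_def)
qed

lemma borel_measurable_vec_nth' [measurable (raw)]:
  fixes f :: "'a \<Rightarrow> real ^ 'y::finite"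
  assumes "f \<in> borel_measurable N"
  shows "(\<lambda>x. f x $ y) \<in> borel_measurable N"
  using assms by (simp add: cart_eq_inner_axis)

text \<open>The defining identity over all sets \<open>B\<close> is an equality of measures. In this
  form it extends from indicators to integrals of arbitrary functions of \<open>Z\<close>.\<close>

lemma is_cond_dist_distr_eq_density:
  fixes Y :: "'e \<Rightarrow> 'y::finite"
  assumes E: "prob_space E" and Y[measurable]: "Y \<in> E \<rightarrow>\<^sub>M count_space UNIV"
    and Z[measurable]: "Z \<in> E \<rightarrow>\<^sub>M MZ" and p: "is_cond_dist E Y MZ Z p"
  shows "distr (density E (indicator {w \<in> space E. Y w = y})) MZ Z
    = density (distr E MZ Z) (\<lambda>z. ennreal (p z $ y))"
proof (rule measure_eqI)
  interpret E: prob_space E by fact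
  interpret L: prob_space "distr E MZ Z" by (rule E.prob_space_distr[OF Z])
  have pm[measurable]: "p \<in> borel_measurable MZ" and ps: "\<And>z. z \<in> space MZ \<Longrightarrow> p z \<in> prob_simplex"
    using p by (auto simp: is_cond_dist_def)
  fix B assume "B \<in> sets (distr (density E (indicator {w \<in> space E. Y w = y})) MZ Z)"
  then have B[measurable]: "B \<in> sets MZ" by simp
  have "emeasure (distr (density E (indicator {w \<in> space E. Y w = y})) MZ Z) B
    = (\<integral>\<^sup>+w. indicator {w \<in> space E. Y w = y} w * indicator (Z -` B \<inter> space E) w \<partial>E)"
    by (simp add: emeasure_distr emeasure_density)
  also have "\<dots> = (\<integral>\<^sup>+w. indicator {w \<in> space E. Y w = y \<and> Z w \<in> B} w \<partial>E)"
    by (intro nn_integral_cong) (auto split: split_indicator)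
  also have "\<dots> = ennreal (measure E {w \<in> space E. Y w = y \<and> Z w \<in> B})"
    by (simp add: E.emeasure_eq_measure)
  also have "\<dots> = ennreal (\<integral>z. indicator B z * p z $ y \<partial>distr E MZ Z)"
    using p by (simp add: is_cond_dist_def set_lebesgue_integral_def)
  also have "\<dots> = (\<integral>\<^sup>+z. ennreal (indicator B z * p z $ y) \<partial>distr E MZ Z)"
  proof (rule nn_integral_eq_integral[symmetric])
    show "integrable (distr E MZ Z) (\<lambda>z. indicator B z * p z $ y)"
      using norm_prob_simplex_nth_le[OF ps]
      by (intro L.integrable_const_bound[where B=1]) (auto intro!: AE_I2 split: split_indicator)
    show "AE z in distr E MZ Z. 0 \<le> indicator B z * p z $ y"
      using ps by (intro AE_I2) (auto simp: prob_simplex_def)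
  qed
  also have "\<dots> = emeasure (density (distr E MZ Z) (\<lambda>z. ennreal (p z $ y))) B"
    by (subst emeasure_density) (auto intro!: nn_integral_cong split: split_indicator)
  finally show "emeasure (distr (density E (indicator {w \<in> space E. Y w = y})) MZ Z) B
    = emeasure (density (distr E MZ Z) (\<lambda>z. ennreal (p z $ y))) B" .
qed simp

text \<open>A form of the tower property. The right-hand side no longer mentions the conditional
  distribution, so versions given different variables can be compared through it.\<close>

lemma is_cond_dist_integral:
  fixes Y :: "'e \<Rightarrow> 'y::finite"
  assumes E: "prob_space E" and Y[measurable]: "Y \<in> E \<rightarrow>\<^sub>M count_space UNIV"
    and Z[measurable]: "Z \<in> E \<rightarrow>\<^sub>M MZ" and p: "is_cond_dist E Y MZ Z p"
    and t[measurable]: "t \<in> borel_measurable MZ"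
  shows "(\<integral>z. t z * p z $ y \<partial>distr E MZ Z) = (\<integral>w. t (Z w) * indicator {w \<in> space E. Y w = y} w \<partial>E)"
proof -
  have [measurable]: "p \<in> borel_measurable MZ"
    using p by (simp add: is_cond_dist_def)
  have "(\<integral>z. t z * p z $ y \<partial>distr E MZ Z)
      = (\<integral>z. t z \<partial>density (distr E MZ Z) (\<lambda>z. ennreal (p z $ y)))"
    using p by (subst integral_density) (auto simp: is_cond_dist_def prob_simplex_def mult.commute)
  also have "\<dots> = (\<integral>w. t (Z w) \<partial>density E (indicator {w \<in> space E. Y w = y}))"
    by (subst is_cond_dist_distr_eq_density[OF E Y Z p, symmetric]) (simp add: integral_distr)
  \<comment> \<open>The \<open>ennreal\<close>-valued indicator is rewritten as the image of a real
    one, the shape that \<open>integral_density\<close> expects.\<close>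
  also have "density E (indicator {w \<in> space E. Y w = y})
      = density E (\<lambda>w. ennreal (indicator {w \<in> space E. Y w = y} w))"
    by (simp add: ennreal_indicator)
  also have "(\<integral>w. t (Z w) \<partial>\<dots>) = (\<integral>w. t (Z w) * indicator {w \<in> space E. Y w = y} w \<partial>E)"
    by (subst integral_density) (auto simp: mult.commute)
  finally show ?thesis .
qed

text \<open>Only the joint law of \<open>Y\<close> and \<open>Z\<close> enters the definition, and
  it is the same on both spaces. This lets two representations be studied on the outcome space of
  the finer one.\<close>

lemma is_cond_dist_distr_iff:
  fixes Y :: "'e \<Rightarrow> 'y::finite"
  assumes [measurable]: "\<theta> \<in> E' \<rightarrow>\<^sub>M E" "Y \<in> E \<rightarrow>\<^sub>M count_space UNIV" "Z \<in> E \<rightarrow>\<^sub>M MZ"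
  shows "is_cond_dist (distr E' E \<theta>) Y MZ Z p \<longleftrightarrow> is_cond_dist E' (\<lambda>w. Y (\<theta> w)) MZ (\<lambda>w. Z (\<theta> w)) p"
proof -
  have "measure (distr E' E \<theta>) {w \<in> space (distr E' E \<theta>). Y w = y \<and> Z w \<in> B}
      = measure E' {w \<in> space E'. Y (\<theta> w) = y \<and> Z (\<theta> w) \<in> B}"
    if [measurable]: "B \<in> sets MZ" for y B
    using measurable_space[OF assms(1)]
    by (subst measure_distr) (auto intro!: arg_cong[where f="measure E'"])
  moreover have "distr (distr E' E \<theta>) MZ Z = distr E' MZ (\<lambda>w. Z (\<theta> w))"
    by (subst distr_distr) (auto simp: comp_def)
  ultimately show ?thesis by (simp add: is_cond_dist_def)
qed

text \<open>Data processing for a concave entropy \<open>h\<close>: up to \<open>e\<close>, \<open>h\<close> at \<open>p z\<close> is a linear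
  functional \<open>T z\<close> dominating \<open>h\<close>, and \<open>T (\<phi> Z') \<bullet> P(Y | Z')\<close> has the same mean as \<open>T (\<phi> Z') \<bullet> P(Y | \<phi> Z')\<close>.\<close>

lemma expected_entropy_mono:
  fixes Y :: "'e \<Rightarrow> 'y::finite"
  assumes E: "prob_space E" and Y[measurable]: "Y \<in> E \<rightarrow>\<^sub>M count_space UNIV"
    and Z'[measurable]: "Z' \<in> E \<rightarrow>\<^sub>M MZ'" and \<phi>[measurable]: "\<phi> \<in> MZ' \<rightarrow>\<^sub>M MZ"
    and p': "is_cond_dist E Y MZ' Z' p'" and p: "is_cond_dist E Y MZ (\<lambda>w. \<phi> (Z' w)) p"
    and h: "continuous_on prob_simplex h" "concave_on prob_simplex h"
  shows "(\<integral>z. h (p' z) \<partial>distr E MZ' Z') \<le> (\<integral>z. h (p z) \<partial>distr E MZ (\<lambda>w. \<phi> (Z' w)))"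
proof (rule field_le_epsilon)
  fix e :: real assume e: "e > 0"
  interpret E: prob_space E by fact
  define L where "L = distr E MZ (\<lambda>w. \<phi> (Z' w))"
  define L' where "L' = distr E MZ' Z'"
  interpret L: prob_space L unfolding L_def by (rule E.prob_space_distr) measurable
  interpret L': prob_space L' unfolding L'_def by (rule E.prob_space_distr) measurable
  have [measurable]: "p \<in> borel_measurable MZ" "p' \<in> borel_measurable MZ'"
    and ps: "\<And>z. z \<in> space MZ \<Longrightarrow> p z \<in> prob_simplex" "\<And>z. z \<in> space MZ' \<Longrightarrow> p' z \<in> prob_simplex"
    using p p' by (auto simp: is_cond_dist_def)
  have [measurable]: "(\<lambda>z. h (p z)) \<in> borel_measurable MZ" "(\<lambda>z. h (p' z)) \<in> borel_measurable MZ'"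
    using ps by (auto intro!: measurable_continuous_on_compose[OF h(1)])
  have [measurable_cong]: "sets L = sets MZ" "sets L' = sets MZ'"
    and sp: "space L = space MZ" "space L' = space MZ'"
    by (simp_all add: L_def L'_def)
  obtain B where B: "\<And>p. p \<in> prob_simplex \<Longrightarrow> norm (h p) \<le> B"
    using compact_imp_bounded[OF compact_continuous_image[OF h(1) compact_prob_simplex]]
    by (auto simp: bounded_iff)
  obtain c :: "nat \<Rightarrow> real ^ 'y" where c: "finite (range c)" "\<forall>i. \<forall>p\<in>prob_simplex. h p \<le> c i \<bullet> p"
      "\<forall>p\<in>prob_simplex. \<exists>i. c i \<bullet> p < h p + e"
    using concave_majorants[OF h e] by blast
  obtain C where C: "\<And>i. norm (c i) \<le> C"
    using finite_imp_bounded[OF c(1)] by (auto simp: bounded_iff)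
  \<comment> \<open>Choosing the least admissible index among countably many keeps the selection
    measurable in \<open>z\<close>.\<close>
  define T where "T z = c (LEAST i. c i \<bullet> p z < h (p z) + e)" for z
  have T[measurable]: "T \<in> borel_measurable MZ"
    unfolding T_def by measurable
  have Tp: "T z \<bullet> p z < h (p z) + e" if "z \<in> space MZ" for z
    unfolding T_def by (rule LeastI_ex[OF c(3)[rule_format, OF ps(1)[OF that]]])
  have TC: "norm (T z $ y * x) \<le> C" if "norm x \<le> 1" for z y x
  proof -
    have "norm (T z $ y) \<le> C"
      unfolding T_def by (rule order_trans[OF Finite_Cartesian_Product.norm_nth_le C])
    then have "norm (T z $ y) * norm x \<le> C * 1"
      using that by (intro mult_mono) (auto intro: order_trans[OF norm_ge_zero])
    then show ?thesis by (simp add: abs_mult)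
  qed
  have intT': "integrable L' (\<lambda>z. T (\<phi> z) $ y * p' z $ y)" for y
    using TC[OF norm_prob_simplex_nth_le[OF ps(2)]]
    by (intro L'.integrable_const_bound[where B=C]) (auto intro!: AE_I2 simp: sp)
  have intT: "integrable L (\<lambda>z. T z $ y * p z $ y)" for y
    using TC[OF norm_prob_simplex_nth_le[OF ps(1)]]
    by (intro L.integrable_const_bound[where B=C]) (auto intro!: AE_I2 simp: sp)
  have inth': "integrable L' (\<lambda>z. h (p' z))"
    using B[OF ps(2)] by (intro L'.integrable_const_bound[where B=B]) (auto intro!: AE_I2 simp: sp)
  have inth: "integrable L (\<lambda>z. h (p z))"
    using B[OF ps(1)] by (intro L.integrable_const_bound[where B=B]) (auto intro!: AE_I2 simp: sp)
  \<comment> \<open>Every \<open>c i\<close> dominates \<open>h\<close> on the whole simplex, so the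
    functional selected at \<open>\<phi> z\<close> for \<open>p\<close> may be applied to
    \<open>p' z\<close>.\<close>
  have "(\<integral>z. h (p' z) \<partial>L') \<le> (\<integral>z. (\<Sum>y\<in>UNIV. T (\<phi> z) $ y * p' z $ y) \<partial>L')"
  proof (rule integral_mono[OF inth'])
    show "h (p' z) \<le> (\<Sum>y\<in>UNIV. T (\<phi> z) $ y * p' z $ y)" if "z \<in> space L'" for z
      using c(2) ps(2)[of z] that by (simp add: T_def sp inner_vec_def)
  qed (simp add: intT')
  also have "\<dots> = (\<Sum>y\<in>UNIV. \<integral>z. T (\<phi> z) $ y * p' z $ y \<partial>L')"
    by (simp add: intT')
  \<comment> \<open>For each \<open>y\<close>, both integrals equal the mean over \<open>E\<close>
    of \<open>T (\<phi> (Z' w)) $ y\<close> on the event \<open>Y w = y\<close>.\<close>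
  also have "\<dots> = (\<Sum>y\<in>UNIV. \<integral>z. T z $ y * p z $ y \<partial>L)"
    unfolding L_def L'_def
    by (intro sum.cong refl, subst is_cond_dist_integral[OF E Y Z' p'], measurable,
        subst is_cond_dist_integral[OF E Y _ p], measurable)
  also have "\<dots> = (\<integral>z. T z \<bullet> p z \<partial>L)"
    by (simp add: intT inner_vec_def)
  also have "\<dots> \<le> (\<integral>z. h (p z) + e \<partial>L)"
    using Tp by (intro integral_mono) (auto simp: inth intT inner_vec_def sp less_imp_le)
  also have "\<dots> = (\<integral>z. h (p z) \<partial>L) + e"
    using inth by (simp add: L.prob_space)
  finally show "(\<integral>z. h (p' z) \<partial>distr E MZ' Z') \<le> (\<integral>z. h (p z) \<partial>distr E MZ (\<lambda>w. \<phi> (Z' w))) + e"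
    unfolding L_def L'_def .
qed

subsection \<open>Kernels with a left inverse\<close>

context
  fixes N :: "'a measure" and N' :: "'b measure" and k \<phi>
  assumes k: "k \<in> N \<rightarrow>\<^sub>M prob_algebra N'" and \<phi>: "\<phi> \<in> N' \<rightarrow>\<^sub>M N"
    and section_k: "\<And>x. x \<in> space N \<Longrightarrow> distr (k x) N \<phi> = return N x"
begin

text \<open>By \<open>section_k\<close>, pushing \<open>k x\<close> back along \<open>\<phi>\<close>
  gives the point mass at \<open>x\<close>; averaging these point masses over \<open>\<rho>\<close>
  restores \<open>\<rho>\<close>.\<close>

lemma distr_bind_section:
  assumes "sets \<rho> = sets N" "space \<rho> \<noteq> {}"
  shows "distr (\<rho> \<bind> k) N \<phi> = \<rho>"
proof -
  have "k \<in> \<rho> \<rightarrow>\<^sub>M subprob_algebra N'"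
    using measurable_prob_algebraD[OF k] by (simp add: measurable_cong_sets[OF assms(1) refl])
  then have "distr (\<rho> \<bind> k) N \<phi> = \<rho> \<bind> (\<lambda>x. distr (k x) N \<phi>)"
    by (rule distr_bind[OF _ assms(2) \<phi>])
  also have "\<dots> = \<rho> \<bind> return \<rho>"
    using section_k sets_eq_imp_space_eq[OF assms(1)] return_sets_cong[OF assms(1)]
    by (intro bind_cong) auto
  finally show ?thesis by (simp add: bind_return')
qed

text \<open>Along \<open>k x\<close> the function \<open>f \<circ> \<phi>\<close> is almost surely
  the constant \<open>f x\<close>, so reweighting before applying the kernel and reweighting after
  it agree.\<close>

lemma density_bind_section:
  assumes \<rho>: "sets \<rho> = sets N" "space \<rho> \<noteq> {}" and f[measurable]: "f \<in> borel_measurable N"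
  shows "density \<rho> f \<bind> k = density (\<rho> \<bind> k) (\<lambda>z. f (\<phi> z))"
proof (rule measure_eqI)
  note [measurable] = \<phi> and [measurable_cong] = \<rho>(1)
  have k'[measurable]: "k \<in> N \<rightarrow>\<^sub>M subprob_algebra N'"
    by (rule measurable_prob_algebraD[OF k])
  have sets_bind: "sets (\<rho> \<bind> k) = sets N'"
    by (rule sets_bind_measurable[OF _ \<rho>(2)]) measurable
  have sets_bind': "sets (density \<rho> f \<bind> k) = sets N'"
    by (rule sets_bind_measurable, measurable) (simp add: \<rho>(2))
  then show "sets (density \<rho> f \<bind> k) = sets (density (\<rho> \<bind> k) (\<lambda>z. f (\<phi> z)))"
    using sets_bind by simp
  note [measurable_cong] = sets_bind
  fix B assume "B \<in> sets (density \<rho> f \<bind> k)"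
  then have B[measurable]: "B \<in> sets N'" by (simp add: sets_bind')
  have inner: "(\<integral>\<^sup>+z. f (\<phi> z) * indicator B z \<partial>k x) = f x * emeasure (k x) B" if x: "x \<in> space N" for x
  proof -
    have [measurable_cong]: "sets (k x) = sets N'"
      by (rule sets_kernel[OF k' x])
    have [measurable]: "\<phi> \<in> k x \<rightarrow>\<^sub>M N"
      using \<phi> by (simp add: measurable_cong_sets[OF sets_kernel[OF k' x] refl])
    \<comment> \<open>Values of \<open>f\<close> are compared, not points: singletons of
      \<open>N\<close> need not be measurable, while this event is.\<close>
    have "AE y in return N x. f y = f x"
      by (subst AE_return[OF x]) simp_all
    then have "AE z in k x. f (\<phi> z) = f x"
      unfolding section_k[OF x, symmetric] by (subst (asm) AE_distr_iff) simp_all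
    then have "(\<integral>\<^sup>+z. f (\<phi> z) * indicator B z \<partial>k x) = (\<integral>\<^sup>+z. f x * indicator B z \<partial>k x)"
      by (intro nn_integral_cong_AE) auto
    then show ?thesis by (simp add: nn_integral_cmult_indicator sets_kernel[OF k' x])
  qed
  have "emeasure (density \<rho> f \<bind> k) B = (\<integral>\<^sup>+x. emeasure (k x) B \<partial>density \<rho> f)"
    using \<rho>(2) by (intro emeasure_bind[where N=N']) simp_all
  also have "\<dots> = (\<integral>\<^sup>+x. f x * emeasure (k x) B \<partial>\<rho>)"
    by (rule nn_integral_density) measurable
  also have "\<dots> = (\<integral>\<^sup>+x. \<integral>\<^sup>+z. f (\<phi> z) * indicator B z \<partial>k x \<partial>\<rho>)"
    using inner sets_eq_imp_space_eq[OF \<rho>(1)] by (intro nn_integral_cong) simp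
  also have "\<dots> = (\<integral>\<^sup>+z. f (\<phi> z) * indicator B z \<partial>(\<rho> \<bind> k))"
    by (rule nn_integral_bind[symmetric, where B=N']) measurable
  also have "\<dots> = emeasure (density (\<rho> \<bind> k) (\<lambda>z. f (\<phi> z))) B"
    by (subst emeasure_density) measurable
  finally show "emeasure (density \<rho> f \<bind> k) B = emeasure (density (\<rho> \<bind> k) (\<lambda>z. f (\<phi> z))) B" .
qed

text \<open>If \<open>f\<close> and \<open>g\<close> are the densities with respect to
  \<open>\<rho>\<close>, then \<open>f \<circ> \<phi>\<close> and \<open>g \<circ> \<phi>\<close>
  are the densities after applying \<open>k\<close>, with respect to
  \<open>\<rho> \<bind> k\<close>. Since \<open>\<phi>\<close> carries the latter back to
  \<open>\<rho>\<close>, the \<open>L1\<close> distance does not change.\<close>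

lemma tv_dist_bind_section:
  assumes \<mu>: "prob_space \<mu>" "sets \<mu> = sets N" and \<nu>: "prob_space \<nu>" "sets \<nu> = sets N"
  shows "tv_dist (\<mu> \<bind> k) (\<nu> \<bind> k) = tv_dist \<mu> \<nu>"
proof -
  note [measurable] = \<phi>
  define \<rho> where "\<rho> = add_measure \<mu> \<nu>"
  interpret \<mu>: prob_space \<mu> by fact
  interpret \<nu>: prob_space \<nu> by fact
  have sets: "sets \<rho> = sets N"
    by (simp add: \<rho>_def add_measure_def \<mu>(2) sets.sigma_sets_eq flip: \<mu>(2))
  have sp: "space \<rho> = space N" "space \<mu> = space N"
    using sets \<mu>(2) by (auto dest: sets_eq_imp_space_eq)
  have ne: "space \<rho> \<noteq> {}"
    using \<mu>.not_empty sp by simp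
  have em: "emeasure \<rho> B = emeasure \<mu> B + emeasure \<nu> B" if "B \<in> sets N" for B
    unfolding \<rho>_def using that \<mu>(2) \<nu>(2) by (simp add: emeasure_add_measure)
  interpret \<rho>: finite_measure \<rho>
  proof (rule finite_measureI)
    show "emeasure \<rho> (space \<rho>) \<noteq> \<infinity>"
      using em[of "space N"] by (simp add: sp ennreal_add_eq_top \<mu>.emeasure_eq_measure \<nu>.emeasure_eq_measure)
  qed
  \<comment> \<open>Domination by \<open>\<rho>\<close> gives a Radon-Nikodym derivative. It is
    finite almost everywhere, so it can be replaced by a real-valued version.\<close>
  have dens: "\<exists>f\<in>borel_measurable N. (\<forall>z. 0 \<le> f z) \<and> \<eta> = density \<rho> (\<lambda>z. ennreal (f z))"
    if \<eta>: "prob_space \<eta>" "sets \<eta> = sets N" "\<And>B. B \<in> sets N \<Longrightarrow> emeasure \<eta> B \<le> emeasure \<rho> B" for \<eta>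
  proof (intro bexI conjI allI)
    let ?f = "\<lambda>z. enn2real (RN_deriv \<rho> \<eta> z)"
    interpret \<eta>: prob_space \<eta> by fact
    have ac: "absolutely_continuous \<rho> \<eta>"
      unfolding absolutely_continuous_def
    proof
      fix B assume "B \<in> null_sets \<rho>"
      then show "B \<in> null_sets \<eta>"
        using \<eta>(3)[of B] by (auto simp: sets \<eta>(2) null_sets_def)
    qed
    have "AE z in \<rho>. RN_deriv \<rho> \<eta> z \<noteq> \<infinity>"
      using \<eta>(2) sets by (intro \<rho>.RN_deriv_finite ac) (auto intro: \<eta>.sigma_finite_measure)
    then have "density \<rho> (\<lambda>z. ennreal (?f z)) = density \<rho> (RN_deriv \<rho> \<eta>)"
      by (intro density_cong) (auto simp: less_top)
    also have "\<dots> = \<eta>"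
      using \<eta>(2) sets by (intro \<rho>.density_RN_deriv ac) simp
    finally show "\<eta> = density \<rho> (\<lambda>z. ennreal (?f z))" by simp
    show "?f \<in> borel_measurable N"
      unfolding measurable_cong_sets[OF sets[symmetric] refl] by measurable
  qed simp
  obtain f where f: "f \<in> borel_measurable N" "\<And>z. 0 \<le> f z" "\<mu> = density \<rho> (\<lambda>z. ennreal (f z))"
    using dens[OF \<mu>] em by auto
  obtain g where g: "g \<in> borel_measurable N" "\<And>z. 0 \<le> g z" "\<nu> = density \<rho> (\<lambda>z. ennreal (g z))"
    using dens[OF \<nu>] em by auto
  note [measurable] = f(1) g(1)
  have [measurable_cong]: "sets (\<rho> \<bind> k) = sets N'"
    using measurable_prob_algebraD[OF k]
    by (intro sets_bind_measurable[OF _ ne]) (simp add: measurable_cong_sets[OF sets refl])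
  have [measurable_cong]: "sets \<rho> = sets N" by (rule sets)
  have "tv_dist (\<mu> \<bind> k) (\<nu> \<bind> k) = 1 / 2 * (\<integral>z. \<bar>f (\<phi> z) - g (\<phi> z)\<bar> \<partial>(\<rho> \<bind> k))"
  proof (rule tv_dist_density)
    show "\<mu> \<bind> k = density (\<rho> \<bind> k) (\<lambda>z. ennreal (f (\<phi> z)))"
      by (subst f(3), rule density_bind_section[OF sets ne]) measurable
    show "\<nu> \<bind> k = density (\<rho> \<bind> k) (\<lambda>z. ennreal (g (\<phi> z)))"
      by (subst g(3), rule density_bind_section[OF sets ne]) measurable
    show "prob_space (\<mu> \<bind> k)" "prob_space (\<nu> \<bind> k)"
      using \<mu> \<nu> by (auto intro!: prob_space_bind'[OF _ k] simp: space_prob_algebra)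
  qed (auto simp: f(2) g(2))
  also have "\<dots> = 1 / 2 * (\<integral>z. \<bar>f z - g z\<bar> \<partial>distr (\<rho> \<bind> k) N \<phi>)"
    by (subst integral_distr) simp_all
  also have "\<dots> = tv_dist \<mu> \<nu>"
    unfolding distr_bind_section[OF sets ne]
    by (rule tv_dist_density[symmetric]) (simp_all add: f(2) g(2) f(3)[symmetric] g(3)[symmetric] \<mu>(1) \<nu>(1))
  finally show ?thesis .
qed

end

section \<open>Laws of a representation and of its refinements\<close>

lemma representationD:
  assumes "representation MX MZ K"
  shows "K \<in> MX \<Otimes>\<^sub>M count_space UNIV \<rightarrow>\<^sub>M prob_algebra MZ"
    and "x \<in> space MX \<Longrightarrow> prob_space (K (x, a))" and "x \<in> space MX \<Longrightarrow> sets (K (x, a)) = sets MZ"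
proof -
  show K: "K \<in> MX \<Otimes>\<^sub>M count_space UNIV \<rightarrow>\<^sub>M prob_algebra MZ"
    using assms by (simp add: representation_def)
  show "prob_space (K (x, a))" "sets (K (x, a)) = sets MZ" if "x \<in> space MX"
    using measurable_space[OF K, of "(x, a)"] that by (auto simp: space_pair_measure space_prob_algebra)
qed

text \<open>Conditioning on \<open>A\<close> restricts only the first coordinate of the enlarged
  space, so it can be carried out on \<open>M\<close> before \<open>Z\<close> is drawn. The enlarged
  space disappears, and the laws can be handled by associativity of \<open>bind\<close>.\<close>

lemma law_given_eq_bind:
  assumes M: "prob_space M" and X[measurable]: "X \<in> M \<rightarrow>\<^sub>M MX" and A[measurable]: "A \<in> M \<rightarrow>\<^sub>M count_space UNIV"
    and K: "representation MX MZ K"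
  shows "law_given a M X A MZ K = uniform_measure M {\<omega> \<in> space M. A \<omega> = a} \<bind> (\<lambda>\<omega>. K (X \<omega>, A \<omega>))"
proof -
  interpret prob_space M by fact
  define E where "E = rep_space M X A MZ K"
  define S where "S = {\<omega> \<in> space M. A \<omega> = a}"
  define k where "k \<omega> = distr (K (X \<omega>, A \<omega>)) (M \<Otimes>\<^sub>M MZ) (\<lambda>z. (\<omega>, z))" for \<omega>
  have [measurable]: "S \<in> sets M" unfolding S_def by measurable
  have [measurable]: "K \<in> MX \<Otimes>\<^sub>M count_space UNIV \<rightarrow>\<^sub>M prob_algebra MZ"
    by (rule representationD[OF K])
  have kp: "k \<in> M \<rightarrow>\<^sub>M prob_algebra (M \<Otimes>\<^sub>M MZ)" unfolding k_def by measurable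
  note k = measurable_prob_algebraD[OF kp]
  have KX: "(\<lambda>\<omega>. K (X \<omega>, A \<omega>)) \<in> M \<rightarrow>\<^sub>M prob_algebra MZ" by measurable
  note KX' = measurable_prob_algebraD[OF KX]
  have setsE[measurable_cong]: "sets E = sets (M \<Otimes>\<^sub>M MZ)"
    unfolding E_def by (rule prob_space_rep_space[OF M X A K])
  have spE: "space E = space M \<times> space MZ"
    using sets_eq_imp_space_eq[OF setsE] by (simp add: space_pair_measure)
  \<comment> \<open>For fixed \<open>\<omega>\<close> the draw stays in the fibre over
    \<open>\<omega>\<close>, so the rectangle receives the mass of \<open>B\<close> or nothing,
    according to whether \<open>\<omega>\<close> lies in \<open>S\<close>.\<close>
  have em: "emeasure E (S \<times> B) = (\<integral>\<^sup>+\<omega>. emeasure (K (X \<omega>, A \<omega>)) B * indicator S \<omega> \<partial>M)"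
    if [measurable]: "B \<in> sets MZ" for B
  proof -
    have "emeasure E (S \<times> B) = (\<integral>\<^sup>+\<omega>. emeasure (k \<omega>) (S \<times> B) \<partial>M)"
      unfolding E_def rep_space_def k_def[symmetric] using not_empty
      by (intro emeasure_bind[OF _ k]) simp_all
    also have "\<dots> = (\<integral>\<^sup>+\<omega>. emeasure (K (X \<omega>, A \<omega>)) B * indicator S \<omega> \<partial>M)"
    proof (rule nn_integral_cong)
      fix \<omega> assume w[measurable]: "\<omega> \<in> space M"
      have [measurable_cong]: "sets (K (X \<omega>, A \<omega>)) = sets MZ"
        by (rule sets_kernel[OF KX' w])
      have "emeasure (k \<omega>) (S \<times> B) = emeasure (K (X \<omega>, A \<omega>)) ((\<lambda>z. (\<omega>, z)) -` (S \<times> B) \<inter> space (K (X \<omega>, A \<omega>)))"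
        unfolding k_def by (rule emeasure_distr) measurable
      also have "(\<lambda>z. (\<omega>, z)) -` (S \<times> B) \<inter> space (K (X \<omega>, A \<omega>)) = (if \<omega> \<in> S then B else {})"
        using sets.sets_into_space[OF that] sets_eq_imp_space_eq[of "K (X \<omega>, A \<omega>)" MZ] \<open>sets (K (X \<omega>, A \<omega>)) = sets MZ\<close> by auto
      finally show "emeasure (k \<omega>) (S \<times> B) = emeasure (K (X \<omega>, A \<omega>)) B * indicator S \<omega>"
        by simp
    qed
    finally show ?thesis .
  qed
  have S_total: "emeasure E (S \<times> space MZ) = emeasure M S"
  proof -
    have "emeasure E (S \<times> space MZ) = (\<integral>\<^sup>+\<omega>. indicator S \<omega> \<partial>M)"
      unfolding em[OF sets.top]
      using measurable_space[OF KX] by (intro nn_integral_cong) (simp add: in_space_prob_algebra)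
    then show ?thesis by simp
  qed
  have SE: "{w \<in> space E. A (fst w) = a} = S \<times> space MZ"
    by (auto simp: spE S_def)
  have ne: "space (uniform_measure M S) \<noteq> {}" using not_empty by simp
  have k_un: "(\<lambda>\<omega>. K (X \<omega>, A \<omega>)) \<in> uniform_measure M S \<rightarrow>\<^sub>M subprob_algebra MZ"
    using KX' by simp
  show ?thesis
    unfolding law_given_def Let_def E_def[symmetric] SE S_def[symmetric]
  proof (rule measure_eqI)
    show "sets (distr (uniform_measure E (S \<times> space MZ)) MZ snd)
        = sets (uniform_measure M S \<bind> (\<lambda>\<omega>. K (X \<omega>, A \<omega>)))"
      using sets_bind_measurable[OF k_un ne] by simp
    fix B assume "B \<in> sets (distr (uniform_measure E (S \<times> space MZ)) MZ snd)"
    then have [measurable]: "B \<in> sets MZ" by simp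
    have "(snd -` B \<inter> space E) = space M \<times> B"
      using sets.sets_into_space[of B MZ] by (auto simp: spE)
    moreover have "(S \<times> space MZ) \<inter> (space M \<times> B) = S \<times> B"
      using sets.sets_into_space[of B MZ] sets.sets_into_space[of S M] by auto
    ultimately have "emeasure (distr (uniform_measure E (S \<times> space MZ)) MZ snd) B
        = emeasure E (S \<times> B) / emeasure M S"
      by (subst emeasure_distr) (simp_all add: S_total)
    also have "\<dots> = (\<integral>\<^sup>+\<omega>. emeasure (K (X \<omega>, A \<omega>)) B \<partial>uniform_measure M S)"
      using measurable_emeasure_kernel[OF KX']
      by (subst nn_integral_uniform_measure) (simp_all add: em)
    also have "\<dots> = emeasure (uniform_measure M S \<bind> (\<lambda>\<omega>. K (X \<omega>, A \<omega>))) B"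
      using ne by (intro emeasure_bind[OF _ k_un, symmetric]) simp_all
    finally show "emeasure (distr (uniform_measure E (S \<times> space MZ)) MZ snd) B
        = emeasure (uniform_measure M S \<bind> (\<lambda>\<omega>. K (X \<omega>, A \<omega>))) B" .
  qed
qed

text \<open>Relabelling the second coordinate commutes with averaging over \<open>\<omega>\<close>.
  Thus the enlarged space of the coarser representation is an image of that of the finer
  one.\<close>

lemma rep_space_distr:
  assumes M: "prob_space M" and X[measurable]: "X \<in> M \<rightarrow>\<^sub>M MX" and A[measurable]: "A \<in> M \<rightarrow>\<^sub>M count_space UNIV"
    and K': "representation MX MZ' K'" and \<phi>[measurable]: "\<phi> \<in> MZ' \<rightarrow>\<^sub>M MZ"
    and K: "\<And>x a. x \<in> space MX \<Longrightarrow> K (x, a) = distr (K' (x, a)) MZ \<phi>"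
  shows "rep_space M X A MZ K = distr (rep_space M X A MZ' K') (M \<Otimes>\<^sub>M MZ) (\<lambda>w. (fst w, \<phi> (snd w)))"
proof -
  interpret prob_space M by fact
  have K'm[measurable]: "K' \<in> MX \<Otimes>\<^sub>M count_space UNIV \<rightarrow>\<^sub>M prob_algebra MZ'"
    by (rule representationD[OF K'])
  have "(\<lambda>\<omega>. distr (K' (X \<omega>, A \<omega>)) (M \<Otimes>\<^sub>M MZ') (\<lambda>z. (\<omega>, z))) \<in> M \<rightarrow>\<^sub>M prob_algebra (M \<Otimes>\<^sub>M MZ')"
    by measurable
  then have "distr (rep_space M X A MZ' K') (M \<Otimes>\<^sub>M MZ) (\<lambda>w. (fst w, \<phi> (snd w)))
      = M \<bind> (\<lambda>\<omega>. distr (distr (K' (X \<omega>, A \<omega>)) (M \<Otimes>\<^sub>M MZ') (\<lambda>z. (\<omega>, z))) (M \<Otimes>\<^sub>M MZ) (\<lambda>w. (fst w, \<phi> (snd w))))"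
    unfolding rep_space_def by (intro distr_bind[OF measurable_prob_algebraD] not_empty) measurable
  also have "\<dots> = rep_space M X A MZ K"
    unfolding rep_space_def
  proof (rule bind_cong[OF refl])
    fix \<omega> assume w[measurable]: "\<omega> \<in> space M"
    then have x: "X \<omega> \<in> space MX" by (rule measurable_space[OF X])
    have [measurable_cong]: "sets (K' (X \<omega>, A \<omega>)) = sets MZ'"
      by (rule representationD(3)[OF K' x])
    show "distr (distr (K' (X \<omega>, A \<omega>)) (M \<Otimes>\<^sub>M MZ') (\<lambda>z. (\<omega>, z))) (M \<Otimes>\<^sub>M MZ) (\<lambda>w. (fst w, \<phi> (snd w)))
        = distr (K (X \<omega>, A \<omega>)) (M \<Otimes>\<^sub>M MZ) (\<lambda>z. (\<omega>, z))"
      unfolding K[OF x] by (simp add: distr_distr comp_def)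
  qed
  finally show ?thesis by simp
qed

text \<open>On the enlarged space of \<open>K'\<close>, the coarser variable becomes the function
  \<open>\<phi>\<close> of the finer one, so \<open>expected_entropy_mono\<close> applies.\<close>

lemma expected_h_refine:
  fixes Y :: "'m \<Rightarrow> 'y::finite" and MZ' :: "'d measure"
  assumes M: "prob_space M" and X[measurable]: "X \<in> M \<rightarrow>\<^sub>M MX" and A[measurable]: "A \<in> M \<rightarrow>\<^sub>M count_space UNIV"
    and Y[measurable]: "Y \<in> M \<rightarrow>\<^sub>M count_space UNIV"
    and h: "continuous_on prob_simplex h" "concave_on prob_simplex h"
    and K: "representation MX MZ K" and K': "representation MX MZ' K'" and \<phi>[measurable]: "\<phi> \<in> MZ' \<rightarrow>\<^sub>M MZ"
    and KK': "\<And>x a. x \<in> space MX \<Longrightarrow> K (x, a) = distr (K' (x, a)) MZ \<phi>"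
  shows "expected_h h M X A Y MZ' K' \<le> expected_h h M X A Y MZ K"
proof -
  define E where "E = rep_space M X A MZ K"
  define E' where "E' = rep_space M X A MZ' K'"
  define \<theta> where "\<theta> w = (fst w, \<phi> (snd w))" for w :: "'m \<times> 'd"
  have E: "prob_space E" and [measurable_cong]: "sets E = sets (M \<Otimes>\<^sub>M MZ)"
    unfolding E_def by (rule prob_space_rep_space[OF M X A K])+
  have E': "prob_space E'" and [measurable_cong]: "sets E' = sets (M \<Otimes>\<^sub>M MZ')"
    unfolding E'_def by (rule prob_space_rep_space[OF M X A K'])+
  have \<theta>[measurable]: "\<theta> \<in> E' \<rightarrow>\<^sub>M E" unfolding \<theta>_def by measurable
  have "E = distr E' (M \<Otimes>\<^sub>M MZ) \<theta>"
    unfolding E_def E'_def \<theta>_def by (rule rep_space_distr[OF M X A K' \<phi> KK'])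
  \<comment> \<open>Only the sets of the target matter to \<open>distr\<close>; naming
    \<open>E\<close> itself as target gives the form used by
    \<open>is_cond_dist_distr_iff\<close>.\<close>
  also have "\<dots> = distr E' E \<theta>"
    by (rule distr_cong) (simp_all add: \<open>sets E = sets (M \<Otimes>\<^sub>M MZ)\<close>)
  finally have EE': "E = distr E' E \<theta>" .
  have "is_cond_dist E (\<lambda>w. Y (fst w)) MZ snd (cond_dist E (\<lambda>w. Y (fst w)) MZ snd)"
    by (rule is_cond_dist_cond_dist[OF E]) measurable
  then have p: "is_cond_dist E' (\<lambda>w. Y (fst w)) MZ (\<lambda>w. \<phi> (snd w)) (cond_dist E (\<lambda>w. Y (fst w)) MZ snd)"
    using is_cond_dist_distr_iff[OF \<theta>, of "\<lambda>w. Y (fst w)" snd MZ] EE'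
    by (simp add: \<theta>_def)
  have p': "is_cond_dist E' (\<lambda>w. Y (fst w)) MZ' snd (cond_dist E' (\<lambda>w. Y (fst w)) MZ' snd)"
    by (rule is_cond_dist_cond_dist[OF E']) measurable
  have "distr E MZ snd = distr (distr E' E \<theta>) MZ snd"
    using EE' by simp
  also have "\<dots> = distr E' MZ (\<lambda>w. \<phi> (snd w))"
    by (subst distr_distr) (simp_all add: comp_def \<theta>_def)
  finally have law: "distr E MZ snd = distr E' MZ (\<lambda>w. \<phi> (snd w))" .
  show ?thesis
    unfolding expected_h_def Let_def E_def[symmetric] E'_def[symmetric] law
    by (rule expected_entropy_mono[OF E' _ _ \<phi> p' p h]) measurable
qed

text \<open>In \<open>law\<close> the kernel \<open>k\<close> is the same for both values of
  \<open>a\<close>. This is what reduces the claim to \<open>tv_dist_bind_section\<close>.\<close>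

lemma D_TV_refine:
  assumes M: "prob_space M" and X[measurable]: "X \<in> M \<rightarrow>\<^sub>M MX" and A[measurable]: "A \<in> M \<rightarrow>\<^sub>M count_space UNIV"
    and pos: "\<And>a. measure M {\<omega> \<in> space M. A \<omega> = a} > 0"
    and K: "representation MX MZ K" and K': "representation MX MZ' K'"
    and k: "k \<in> MZ \<rightarrow>\<^sub>M prob_algebra MZ'" and \<phi>: "\<phi> \<in> MZ' \<rightarrow>\<^sub>M MZ"
    and section_k: "\<And>z. z \<in> space MZ \<Longrightarrow> distr (k z) MZ \<phi> = return MZ z"
    and law: "\<And>a. law_given a M X A MZ' K' = law_given a M X A MZ K \<bind> k"
  shows "D_TV M X A MZ' K' = D_TV M X A MZ K"
proof -
  interpret prob_space M by fact
  have [measurable]: "K \<in> MX \<Otimes>\<^sub>M count_space UNIV \<rightarrow>\<^sub>M prob_algebra MZ"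
    by (rule representationD[OF K])
  have prob: "prob_space (law_given a M X A MZ K)" for a
  proof -
    have "prob_space (uniform_measure M {\<omega> \<in> space M. A \<omega> = a})"
      using pos[of a] by (intro prob_space_uniform_measure) (auto simp: emeasure_eq_measure)
    moreover have "(\<lambda>\<omega>. K (X \<omega>, A \<omega>)) \<in> uniform_measure M {\<omega> \<in> space M. A \<omega> = a} \<rightarrow>\<^sub>M prob_algebra MZ"
      by measurable
    ultimately show ?thesis
      unfolding law_given_eq_bind[OF M X A K]
      by (intro prob_space_bind'[where M="uniform_measure M {\<omega> \<in> space M. A \<omega> = a}" and N=MZ])
        (simp_all add: space_prob_algebra)
  qed
  have sets: "sets (law_given a M X A MZ K) = sets MZ" for a
    by (simp add: law_given_def Let_def)
  show ?thesis
    unfolding D_TV_def law by (rule tv_dist_bind_section[OF k \<phi> section_k prob sets prob sets])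
qed

subsection \<open>Invertible refinements\<close>

text \<open>The independent uniform coordinate makes every singleton null under \<open>K'\<close>,
  so no point has a preimage \<open>x\<close> of positive probability.\<close>

lemma refine_by_uniform:
  fixes M :: "'m measure" and MX :: "'x measure" and MZ :: "'z measure" and Y :: "'m \<Rightarrow> 'y::finite"
  assumes M: "prob_space M" and X[measurable]: "X \<in> M \<rightarrow>\<^sub>M MX" and A[measurable]: "A \<in> M \<rightarrow>\<^sub>M count_space UNIV"
    and Y: "Y \<in> M \<rightarrow>\<^sub>M count_space UNIV"
    and pos: "\<And>a. measure M {\<omega> \<in> space M. A \<omega> = a} > 0"
    and h: "continuous_on prob_simplex h" "concave_on prob_simplex h"
    and K: "representation MX MZ K"
  shows "\<exists>(MZ' :: ('z \<times> 'x \<times> 'x \<times> real) measure) K'.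
    representation MX MZ' K' \<and> invertible_rep MX MZ' K' \<and>
    expected_h h M X A Y MZ' K' \<le> expected_h h M X A Y MZ K \<and>
    D_TV M X A MZ' K' = D_TV M X A MZ K"
proof -
  interpret prob_space M by fact
  \<comment> \<open>An arbitrary filler: the two middle components are constant here and serve only
    to share the type of \<open>Z'\<close> with the coupling construction.\<close>
  define x0 :: 'x where "x0 = undefined"
  define U :: "real measure" where "U = uniform_measure lborel {0..1}"
  define MZ' where "MZ' = MZ \<Otimes>\<^sub>M count_space {x0} \<Otimes>\<^sub>M count_space {x0} \<Otimes>\<^sub>M (borel :: real measure)"
  define k where "k z = distr U MZ' (\<lambda>r. (z, x0, x0, r))" for z
  define K' where "K' w = K w \<bind> k" for w
  have U: "prob_space U"
    unfolding U_def by (rule prob_space_uniform_measure) auto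
  have [measurable_cong]: "sets U = sets borel" by (simp add: U_def)
  have [measurable]: "U \<in> space (prob_algebra borel)"
    using U by (simp add: space_prob_algebra U_def)
  have Km[measurable]: "K \<in> MX \<Otimes>\<^sub>M count_space UNIV \<rightarrow>\<^sub>M prob_algebra MZ"
    by (rule representationD[OF K])
  have k[measurable]: "k \<in> MZ \<rightarrow>\<^sub>M prob_algebra MZ'"
    unfolding k_def MZ'_def by measurable
  have \<phi>[measurable]: "fst \<in> MZ' \<rightarrow>\<^sub>M MZ"
    unfolding MZ'_def by measurable
  have section_k: "distr (k z) MZ fst = return MZ z" if z[measurable]: "z \<in> space MZ" for z
  proof -
    have "(\<lambda>r. (z, x0, x0, r)) \<in> U \<rightarrow>\<^sub>M MZ'"
      unfolding MZ'_def by measurable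
    then have "distr (k z) MZ fst = distr U MZ (\<lambda>r. z)"
      unfolding k_def by (subst distr_distr) (simp_all add: comp_def)
    then show ?thesis using prob_space.distr_const[OF U z] by simp
  qed
  have single: "{z'} \<in> sets MZ'" if z': "z' \<in> space MZ'" for z'
  proof -
    obtain z r where zr: "z' = (z, x0, x0, r)" "z \<in> space MZ"
      using z' by (auto simp: MZ'_def space_pair_measure)
    then have "{z} \<in> sets MZ" using K by (simp add: representation_def)
    then have "{z} \<times> {x0} \<times> {x0} \<times> {r} \<in> sets MZ'"
      unfolding MZ'_def by (intro pair_measureI) auto
    then show ?thesis by (simp add: zr)
  qed
  have K': "representation MX MZ' K'"
    unfolding representation_def
  proof (intro conjI ballI)
    show "K' \<in> MX \<Otimes>\<^sub>M count_space UNIV \<rightarrow>\<^sub>M prob_algebra MZ'"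
      unfolding K'_def by (rule measurable_bind_prob_space[OF Km k])
  qed (rule single)
  have K_space: "K (x, a) \<in> space (prob_algebra MZ)" if "x \<in> space MX" for x a
    using representationD(2,3)[OF K that] by (simp add: space_prob_algebra)
  have atomless: "measure (K' (x, a)) {z'} = 0" if x: "x \<in> space MX" and z': "z' \<in> space MZ'" for x a z'
  proof -
    \<comment> \<open>At most one value of \<open>r\<close> can produce \<open>z'\<close>, and a
      single real is null for the uniform law.\<close>
    have "emeasure (k z) {z'} = 0" if z[measurable]: "z \<in> space MZ" for z
    proof -
      have [measurable]: "(\<lambda>r. (z, x0, x0, r)) \<in> U \<rightarrow>\<^sub>M MZ'"
        unfolding MZ'_def by measurable
      have "emeasure (k z) {z'} = emeasure U ((\<lambda>r. (z, x0, x0, r)) -` {z'} \<inter> space U)"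
        unfolding k_def by (rule emeasure_distr) (simp_all add: single[OF z'])
      also have "\<dots> \<le> emeasure U {snd (snd (snd z'))}"
        by (rule emeasure_mono) (auto simp: U_def)
      also have "\<dots> = 0"
        by (simp add: U_def emeasure_lborel_countable)
      finally show ?thesis by simp
    qed
    then have "emeasure (K' (x, a)) {z'} = (\<integral>\<^sup>+z. 0 \<partial>K (x, a))"
      unfolding K'_def emeasure_bind_prob_algebra[OF K_space[OF x] k single[OF z']]
      using sets_eq_imp_space_eq[OF representationD(3)[OF K x]] by (intro nn_integral_cong) simp
    then show ?thesis by (simp add: measure_def)
  qed
  have inv: "invertible_rep MX MZ' K'"
    unfolding invertible_rep_def Uniq_def using atomless by fastforce
  have KK': "K (x, a) = distr (K' (x, a)) MZ fst" if x: "x \<in> space MX" for x a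
    unfolding K'_def
    using prob_space.not_empty[OF representationD(2)[OF K x]]
    by (intro distr_bind_section[OF k \<phi> section_k representationD(3)[OF K x], symmetric])
  have law: "law_given a M X A MZ' K' = law_given a M X A MZ K \<bind> k" for a
    unfolding law_given_eq_bind[OF M X A K] law_given_eq_bind[OF M X A K'] K'_def
    by (rule bind_assoc[symmetric, where N=MZ and R=MZ']; rule measurable_prob_algebraD) measurable
  show ?thesis
    using K' inv expected_h_refine[OF M X A Y h K K' \<phi> KK'] D_TV_refine[OF M X A pos K K' k \<phi> section_k law]
    by blast
qed

section \<open>Discrete spaces and the coupling\<close>

lemma discrete_spaceD:
  assumes "discrete_space D"
  shows "f \<in> D \<rightarrow>\<^sub>M N \<longleftrightarrow> f \<in> space D \<rightarrow> space N" "B \<in> sets D \<longleftrightarrow> B \<subseteq> space D"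
proof -
  have "sets D = sets (count_space (space D))"
    using assms by (simp add: discrete_space_def)
  then show "f \<in> D \<rightarrow>\<^sub>M N \<longleftrightarrow> f \<in> space D \<rightarrow> space N"
    by (simp add: measurable_cong_sets[of D "count_space (space D)" N N])
  show "B \<in> sets D \<longleftrightarrow> B \<subseteq> space D"
    using assms by (simp add: discrete_space_def)
qed

lemma discrete_space_pair:
  assumes "discrete_space D" "discrete_space D'"
  shows "discrete_space (D \<Otimes>\<^sub>M D')"
  using assms sets_pair_countable[of "space D" "space D'" D D']
  by (simp add: discrete_space_def space_pair_measure)

text \<open>Over a countable space, elementary conditioning on each fibre gives the kernel,
  measurability is automatic, and equality of measures is checked on points.\<close>

lemma discrete_disintegration:
  fixes MZ :: "'z measure" and MX :: "'x measure"
  assumes MZ: "discrete_space MZ" and MX: "discrete_space MX" and J: "J \<in> space (prob_algebra (MZ \<Otimes>\<^sub>M MX))"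
  shows "\<exists>\<kappa>. \<kappa> \<in> MZ \<rightarrow>\<^sub>M prob_algebra MX \<and> J = distr J MZ fst \<bind> (\<lambda>z. distr (\<kappa> z) (MZ \<Otimes>\<^sub>M MX) (\<lambda>x. (z, x)))"
proof -
  interpret J: prob_space J using J by (simp add: space_prob_algebra)
  have sets[measurable_cong]: "sets J = sets (MZ \<Otimes>\<^sub>M MX)" using J by (simp add: space_prob_algebra)
  note sp = sets_eq_imp_space_eq[OF sets, unfolded space_pair_measure]
  have D: "discrete_space (MZ \<Otimes>\<^sub>M MX)" by (rule discrete_space_pair[OF MZ MX])
  have in_J: "B \<in> sets J \<longleftrightarrow> B \<subseteq> space MZ \<times> space MX" for B
    using discrete_spaceD(2)[OF D] by (simp add: sets space_pair_measure)
  obtain x0 where x0: "x0 \<in> space MX" using J.not_empty sp by auto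
  define F where "F z = {z} \<times> space MX" for z :: 'z
  \<comment> \<open>On null fibres any law would do; the point mass at \<open>x0\<close> keeps
    \<open>\<kappa>\<close> a Markov kernel everywhere.\<close>
  define \<kappa> where "\<kappa> z = (if emeasure J (F z) = 0 then return MX x0 else distr (uniform_measure J (F z)) MX snd)" for z
  have \<kappa>_space: "\<kappa> z \<in> space (prob_algebra MX)" for z
  proof (cases "emeasure J (F z) = 0")
    case True
    then show ?thesis using x0 by (simp add: \<kappa>_def space_prob_algebra prob_space_return)
  next
    case False
    then have "prob_space (uniform_measure J (F z))"
      by (intro prob_space_uniform_measure) simp_all
    then show ?thesis
      using False by (auto simp: \<kappa>_def space_prob_algebra intro!: prob_space.prob_space_distr)
  qed
  have \<kappa>[measurable]: "\<kappa> \<in> MZ \<rightarrow>\<^sub>M prob_algebra MX"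
    using \<kappa>_space by (simp add: discrete_spaceD(1)[OF MZ])
  define k where "k z = distr (\<kappa> z) (MZ \<Otimes>\<^sub>M MX) (\<lambda>x. (z, x))" for z
  have k: "k \<in> MZ \<rightarrow>\<^sub>M prob_algebra (MZ \<Otimes>\<^sub>M MX)" unfolding k_def by measurable
  have L: "distr J MZ fst \<in> space (prob_algebra MZ)"
    by (simp add: space_prob_algebra J.prob_space_distr)
  have "J = distr J MZ fst \<bind> k"
  proof (rule measure_eqI_countable)
    show "sets J = Pow (space MZ \<times> space MX)" using in_J by blast
    then show "sets (distr J MZ fst \<bind> k) = Pow (space MZ \<times> space MX)"
      by (simp add: sets_bind'[OF L k] sets)
    show "countable (space MZ \<times> space MX)"
      using MZ MX by (simp add: discrete_space_def)
    fix w assume w: "w \<in> space MZ \<times> space MX"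
    then obtain z x where zx: "w = (z, x)" "z \<in> space MZ" "x \<in> space MX" by auto
    have wm[measurable]: "{w} \<in> sets (MZ \<Otimes>\<^sub>M MX)" using w in_J[of "{w}"] sets by simp
    have [measurable]: "{z} \<in> sets MZ" "{x} \<in> sets MX"
      using zx by (simp_all add: discrete_spaceD(2)[OF MZ] discrete_spaceD(2)[OF MX])
    have "emeasure (distr J MZ fst \<bind> k) {w} = (\<integral>\<^sup>+z'. emeasure (k z') {w} \<partial>distr J MZ fst)"
      by (rule emeasure_bind_prob_algebra[OF L k wm])
    also have "\<dots> = (\<integral>\<^sup>+z'. emeasure (\<kappa> z) {x} * indicator {z} z' \<partial>distr J MZ fst)"
    proof (rule nn_integral_cong)
      fix z' assume "z' \<in> space (distr J MZ fst)"
      then have z'[measurable]: "z' \<in> space MZ" by simp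
      have [measurable_cong]: "sets (\<kappa> z') = sets MX" using \<kappa>_space[of z'] by (simp add: space_prob_algebra)
      have "emeasure (k z') {w} = emeasure (\<kappa> z') ((\<lambda>x. (z', x)) -` {w} \<inter> space (\<kappa> z'))"
        unfolding k_def by (rule emeasure_distr) measurable
      also have "(\<lambda>x. (z', x)) -` {w} \<inter> space (\<kappa> z') = (if z' = z then {x} else {})"
        using zx sets_eq_imp_space_eq[of "\<kappa> z'" MX] \<open>sets (\<kappa> z') = sets MX\<close> by auto
      finally show "emeasure (k z') {w} = emeasure (\<kappa> z) {x} * indicator {z} z'" by simp
    qed
    also have "\<dots> = emeasure (\<kappa> z) {x} * emeasure (distr J MZ fst) {z}"
      by (rule nn_integral_cmult_indicator) simp
    also have "emeasure (distr J MZ fst) {z} = emeasure J (F z)"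
      by (subst emeasure_distr) (auto simp: sp F_def zx intro!: arg_cong[where f="emeasure J"])
    \<comment> \<open>Either the fibre is null and both sides vanish, or the normalising factor of
      the conditional law cancels.\<close>
    also have "emeasure (\<kappa> z) {x} * emeasure J (F z) = emeasure J {w}"
    proof (cases "emeasure J (F z) = 0")
      case True
      moreover have "emeasure J {w} \<le> emeasure J (F z)"
        using zx by (intro emeasure_mono) (auto simp: F_def in_J)
      ultimately show ?thesis by simp
    next
      case False
      have "emeasure (\<kappa> z) {x} = emeasure (uniform_measure J (F z)) (snd -` {x} \<inter> space J)"
        using False by (simp add: \<kappa>_def emeasure_distr)
      also have "\<dots> = emeasure J (F z \<inter> (snd -` {x} \<inter> space J)) / emeasure J (F z)"
        using zx by (intro emeasure_uniform_measure) (auto simp: F_def in_J sp)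
      also have "F z \<inter> (snd -` {x} \<inter> space J) = {w}"
        using zx by (auto simp: F_def sp)
      finally show ?thesis
        using False by (simp add: J.emeasure_eq_measure divide_ennreal zero_less_measure_iff flip: ennreal_mult)
    qed
    finally show "emeasure J {w} = emeasure (distr J MZ fst \<bind> k) {w}" ..
  qed
  with \<kappa> show ?thesis unfolding k_def by blast
qed

text \<open>Given \<open>z\<close>, the true \<open>x\<close> is kept in the slot numbered
  \<open>a\<close> and the other slot is resampled. Invertibility comes from reading slot
  \<open>a\<close>; equality of the distances comes from \<open>couple\<close>, where the dependence
  on \<open>a\<close> averages out.\<close>

lemma refine_by_coupling:
  fixes M :: "'m measure" and MX :: "'x measure" and MZ :: "'z measure" and Y :: "'m \<Rightarrow> 'y::finite"
  assumes M: "prob_space M" and X[measurable]: "X \<in> M \<rightarrow>\<^sub>M MX" and A[measurable]: "A \<in> M \<rightarrow>\<^sub>M count_space UNIV"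
    and Y: "Y \<in> M \<rightarrow>\<^sub>M count_space UNIV"
    and pos: "\<And>a. measure M {\<omega> \<in> space M. A \<omega> = a} > 0"
    and h: "continuous_on prob_simplex h" "concave_on prob_simplex h"
    and K: "representation MX MZ K" and MX: "discrete_space MX" and MZ: "discrete_space MZ"
  shows "\<exists>(MZ' :: ('z \<times> 'x \<times> 'x \<times> real) measure) K'.
    representation MX MZ' K' \<and> invertible_rep MX MZ' K' \<and> discrete_space MZ' \<and>
    expected_h h M X A Y MZ' K' \<le> expected_h h M X A Y MZ K \<and>
    D_TV M X A MZ' K' = D_TV M X A MZ K"
proof -
  interpret prob_space M by fact
  note measurable_prob_algebraD[measurable_dest]
  have Km[measurable]: "K \<in> MX \<Otimes>\<^sub>M count_space UNIV \<rightarrow>\<^sub>M prob_algebra MZ"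
    by (rule representationD[OF K])
  have K_space: "K (x, a) \<in> space (prob_algebra MZ)" if "x \<in> space MX" for x a
    using representationD(2,3)[OF K that] by (simp add: space_prob_algebra)
  have D: "discrete_space (MZ \<Otimes>\<^sub>M MX)" by (rule discrete_space_pair[OF MZ MX])
  define \<nu> where "\<nu> a = uniform_measure M {\<omega> \<in> space M. A \<omega> = a}" for a
  have \<nu>: "prob_space (\<nu> a)" for a
    unfolding \<nu>_def using pos[of a] by (intro prob_space_uniform_measure) (auto simp: emeasure_eq_measure)
  have [measurable_cong]: "sets (\<nu> a) = sets M" for a by (simp add: \<nu>_def)
  have \<nu>_space: "\<nu> a \<in> space (prob_algebra M)" for a
    using \<nu> by (simp add: space_prob_algebra \<nu>_def)
  have \<nu>_ne: "space (\<nu> a) \<noteq> {}" for a by (rule prob_space.not_empty[OF \<nu>])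
  have \<nu>_AE: "AE \<omega> in \<nu> a. A \<omega> = a" for a
    unfolding \<nu>_def by (rule AE_uniform_measureI) auto
  \<comment> \<open>The joint law of \<open>(Z, X)\<close> given \<open>A = a\<close>; its
    disintegration \<open>\<kappa> a z\<close> is the law of \<open>X\<close> given
    \<open>Z = z\<close> and \<open>A = a\<close>.\<close>
  define J where "J a = \<nu> a \<bind> (\<lambda>\<omega>. distr (K (X \<omega>, a)) (MZ \<Otimes>\<^sub>M MX) (\<lambda>z. (z, X \<omega>)))" for a
  have Jk[measurable]: "(\<lambda>\<omega>. distr (K (X \<omega>, a)) (MZ \<Otimes>\<^sub>M MX) (\<lambda>z. (z, X \<omega>))) \<in> M \<rightarrow>\<^sub>M prob_algebra (MZ \<Otimes>\<^sub>M MX)" for a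
    by measurable
  have J: "J a \<in> space (prob_algebra (MZ \<Otimes>\<^sub>M MX))" for a
    using prob_space_bind'[OF \<nu>_space Jk] sets_bind'[OF \<nu>_space Jk] by (simp add: space_prob_algebra J_def)
  have "\<exists>\<kappa>. \<forall>a. \<kappa> a \<in> MZ \<rightarrow>\<^sub>M prob_algebra MX \<and>
      J a = distr (J a) MZ fst \<bind> (\<lambda>z. distr (\<kappa> a z) (MZ \<Otimes>\<^sub>M MX) (\<lambda>x. (z, x)))"
    using discrete_disintegration[OF MZ MX J] by (intro choice allI)
  then obtain \<kappa> where \<kappa>[measurable]: "\<And>a. \<kappa> a \<in> MZ \<rightarrow>\<^sub>M prob_algebra MX"
    and J_eq: "\<And>a. J a = distr (J a) MZ fst \<bind> (\<lambda>z. distr (\<kappa> a z) (MZ \<Otimes>\<^sub>M MX) (\<lambda>x. (z, x)))"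
    by blast
  have \<kappa>_prob: "prob_space (\<kappa> a z)" and \<kappa>_sets: "sets (\<kappa> a z) = sets MX" and \<kappa>_sp: "space (\<kappa> a z) = space MX"
    if "z \<in> space MZ" for a z
    using measurable_space[OF \<kappa> that, of a] by (auto simp: space_prob_algebra dest: sets_eq_imp_space_eq)

  \<comment> \<open>The last component is fixed at 0 and only fills the slot that the other
    construction uses for the uniform variable.\<close>
  define MZ' :: "('z \<times> 'x \<times> 'x \<times> real) measure" where
    "MZ' = count_space (space MZ \<times> space MX \<times> space MX \<times> {0})"
  define c :: "bool \<Rightarrow> 'z \<Rightarrow> 'x \<Rightarrow> 'x \<Rightarrow> 'z \<times> 'x \<times> 'x \<times> real" where
    "c a z x x' = (z, if a then x' else x, if a then x else x', 0)" for a z x x'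
  \<comment> \<open>\<open>G a z x\<close> knows the true \<open>x\<close> and resamples the
    counterfactual value from \<open>\<kappa> (\<not> a) z\<close>, whereas \<open>k z\<close> draws
    both values independently.\<close>
  define G where "G a z x = distr (\<kappa> (\<not> a) z) MZ' (c a z x)" for a z x
  define k where "k z = distr (\<kappa> False z \<Otimes>\<^sub>M \<kappa> True z) MZ' (\<lambda>(x, x'). (z, x, x', 0))" for z
  define K' where "K' w = K w \<bind> (\<lambda>z. G (snd w) z (fst w))" for w
  have D': "discrete_space MZ'"
    using MX MZ by (simp add: discrete_space_def MZ'_def)
  have c: "c a z x x' \<in> space MZ'" if "z \<in> space MZ" "x \<in> space MX" "x' \<in> space MX" for a z x x'
    using that by (simp add: MZ'_def c_def)
  have cm: "c a z x \<in> \<kappa> b z \<rightarrow>\<^sub>M MZ'" if "z \<in> space MZ" "x \<in> space MX" for a b z x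
    using c that by (simp add: measurable_cong_sets[OF \<kappa>_sets refl] discrete_spaceD(1)[OF MX])
  have G_space: "G a z x \<in> space (prob_algebra MZ')" if "z \<in> space MZ" "x \<in> space MX" for a z x
    using cm[OF that] \<kappa>_prob[OF that(1)]
    by (auto simp: G_def space_prob_algebra intro!: prob_space.prob_space_distr)
  have Gm[measurable]: "(\<lambda>(z, x). G a z x) \<in> MZ \<Otimes>\<^sub>M MX \<rightarrow>\<^sub>M prob_algebra MZ'" for a
    using G_space by (auto simp: discrete_spaceD(1)[OF D] space_pair_measure)
  have Gz: "(\<lambda>z. G a z x) \<in> MZ \<rightarrow>\<^sub>M prob_algebra MZ'" if "x \<in> space MX" for a x
    using G_space that by (auto simp: discrete_spaceD(1)[OF MZ])
  have \<phi>[measurable]: "fst \<in> MZ' \<rightarrow>\<^sub>M MZ"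
    by (auto simp: MZ'_def)
  have K'_space: "K' (x, a) \<in> space (prob_algebra MZ')" if "x \<in> space MX" for x a
    using prob_space_bind'[OF K_space[OF that] Gz[OF that]] sets_bind'[OF K_space[OF that] Gz[OF that]]
    by (simp add: K'_def space_prob_algebra)
  have K': "representation MX MZ' K'"
    unfolding representation_def
  proof (intro conjI ballI)
    have "discrete_space (MX \<Otimes>\<^sub>M (count_space UNIV :: bool measure))"
      by (rule discrete_space_pair[OF MX]) (simp add: discrete_space_def)
    from discrete_spaceD(1)[OF this]
    show "K' \<in> MX \<Otimes>\<^sub>M count_space UNIV \<rightarrow>\<^sub>M prob_algebra MZ'"
      using K'_space by (auto simp: space_pair_measure)
  qed (simp add: discrete_spaceD(2)[OF D'])
  have inv: "invertible_rep MX MZ' K'"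
    unfolding invertible_rep_def
  proof (intro ballI allI Uniq_I)
    fix z' a x1 x2 assume z': "z' \<in> space MZ'"
    \<comment> \<open>Under \<open>K' (x, a)\<close> the slot of \<open>a\<close> always carries
      \<open>x\<close>, so a point \<open>z'\<close> with another entry there has mass zero.\<close>
    have "x = (if a then fst (snd (snd z')) else fst (snd z'))"
      if x: "x \<in> space MX" and pos: "0 < measure (K' (x, a)) {z'}" for x
    proof (rule ccontr)
      assume ne: "x \<noteq> (if a then fst (snd (snd z')) else fst (snd z'))"
      have z'm: "{z'} \<in> sets MZ'" using z' by (simp add: discrete_spaceD(2)[OF D'])
      have "emeasure (G a z x) {z'} = 0" if z: "z \<in> space MZ" for z
      proof -
        have "c a z x -` {z'} = {}" using ne by (cases a) (auto simp: c_def)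
        then show ?thesis
          unfolding G_def using cm[OF z x] z'm by (subst emeasure_distr) auto
      qed
      then have "emeasure (K' (x, a)) {z'} = (\<integral>\<^sup>+z. 0 \<partial>K (x, a))"
        unfolding K'_def fst_conv snd_conv emeasure_bind_prob_algebra[OF K_space[OF x] Gz[OF x] z'm]
        using sets_eq_imp_space_eq[OF representationD(3)[OF K x]] by (intro nn_integral_cong) simp
      with pos show False by (simp add: measure_def)
    qed
    then show "x1 \<in> space MX \<and> 0 < measure (K' (x1, a)) {z'} \<Longrightarrow>
        x2 \<in> space MX \<and> 0 < measure (K' (x2, a)) {z'} \<Longrightarrow> x1 = x2" by metis
  qed
  have km: "(\<lambda>(x, x'). (z, x, x', 0)) \<in> \<kappa> False z \<Otimes>\<^sub>M \<kappa> True z \<rightarrow>\<^sub>M MZ'" if z: "z \<in> space MZ" for z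
    unfolding measurable_cong_sets[OF sets_pair_measure_cong[OF \<kappa>_sets[OF z] \<kappa>_sets[OF z]] refl]
      discrete_spaceD(1)[OF discrete_space_pair[OF MX MX]]
    using z by (auto simp: space_pair_measure MZ'_def)
  have pair: "prob_space (\<kappa> False z \<Otimes>\<^sub>M \<kappa> True z)" if z: "z \<in> space MZ" for z
    by (rule prob_space_pair) (rule \<kappa>_prob[OF z])+
  have k: "k \<in> MZ \<rightarrow>\<^sub>M prob_algebra MZ'"
    using km pair
    by (auto simp: discrete_spaceD(1)[OF MZ] k_def space_prob_algebra intro!: prob_space.prob_space_distr)
  have section_k: "distr (k z) MZ fst = return MZ z" if z: "z \<in> space MZ" for z
  proof -
    have "distr (k z) MZ fst = distr (\<kappa> False z \<Otimes>\<^sub>M \<kappa> True z) MZ (\<lambda>_. z)"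
      unfolding k_def by (subst distr_distr[OF \<phi> km[OF z]]) (simp add: comp_def case_prod_beta)
    then show ?thesis using prob_space.distr_const[OF pair[OF z] z] by simp
  qed
  have KK': "K (x, a) = distr (K' (x, a)) MZ fst" if x: "x \<in> space MX" for x a
    unfolding K'_def fst_conv snd_conv
  proof (rule distr_bind_section[OF Gz[OF x] \<phi> _ representationD(3)[OF K x], symmetric])
    show "space (K (x, a)) \<noteq> {}" by (rule prob_space.not_empty[OF representationD(2)[OF K x]])
    fix z assume z: "z \<in> space MZ"
    have "distr (G a z x) MZ fst = distr (\<kappa> (\<not> a) z) MZ (\<lambda>_. z)"
      unfolding G_def by (subst distr_distr[OF \<phi> cm[OF z x]]) (simp add: comp_def c_def)
    then show "distr (G a z x) MZ fst = return MZ z"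
      using prob_space.distr_const[OF \<kappa>_prob[OF z] z] by simp
  qed
  \<comment> \<open>Once the true value is itself drawn from \<open>\<kappa> a z\<close>, the slots
    are independent with laws \<open>\<kappa> False z\<close> and \<open>\<kappa> True z\<close>,
    whichever \<open>a\<close> is.\<close>
  have couple: "\<kappa> a z \<bind> G a z = k z" if z: "z \<in> space MZ" for a z
  proof (rule measure_eqI)
    have \<kappa>_space: "\<kappa> a z \<in> space (prob_algebra MX)" for a
      using \<kappa>_prob[OF z] \<kappa>_sets[OF z] by (simp add: space_prob_algebra)
    have Gx: "G a z \<in> MX \<rightarrow>\<^sub>M prob_algebra MZ'"
      using G_space z by (simp add: discrete_spaceD(1)[OF MX])
    show "sets (\<kappa> a z \<bind> G a z) = sets (k z)"
      by (simp add: sets_bind'[OF \<kappa>_space Gx] k_def)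
    fix B assume "B \<in> sets (\<kappa> a z \<bind> G a z)"
    then have B: "B \<in> sets MZ'" by (simp add: sets_bind'[OF \<kappa>_space Gx])
    interpret F: prob_space "\<kappa> False z" by (rule \<kappa>_prob[OF z])
    interpret T: prob_space "\<kappa> True z" by (rule \<kappa>_prob[OF z])
    interpret pair_prob_space "\<kappa> False z" "\<kappa> True z" ..
    define Q where "Q = {(x, x'). (z, x, x', 0) \<in> B} \<inter> (space MX \<times> space MX)"
    have Q: "Q \<in> sets (\<kappa> False z \<Otimes>\<^sub>M \<kappa> True z)"
      using discrete_spaceD(2)[OF discrete_space_pair[OF MX MX]]
        sets_pair_measure_cong[OF \<kappa>_sets[OF z] \<kappa>_sets[OF z]]
      by (auto simp: Q_def space_pair_measure)
    have "emeasure (k z) B = emeasure (\<kappa> False z \<Otimes>\<^sub>M \<kappa> True z) Q"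
      unfolding k_def emeasure_distr[OF km[OF z] B]
      by (auto simp: Q_def space_pair_measure \<kappa>_sp[OF z] intro!: arg_cong[where f="emeasure _"])
    \<comment> \<open>Fubini, in the order that leaves the true value in the outer integral; hence
      the case distinction on \<open>a\<close>.\<close>
    also have "\<dots> = (\<integral>\<^sup>+x. emeasure (G a z x) B \<partial>\<kappa> a z)"
    proof (cases a)
      case True
      have "emeasure (\<kappa> False z \<Otimes>\<^sub>M \<kappa> True z) Q = (\<integral>\<^sup>+x'. emeasure (\<kappa> False z) ((\<lambda>x. (x, x')) -` Q) \<partial>\<kappa> True z)"
        by (rule emeasure_pair_measure_alt2[OF Q])
      also have "\<dots> = (\<integral>\<^sup>+x. emeasure (G a z x) B \<partial>\<kappa> a z)"
        unfolding G_def using True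
        by (auto simp: emeasure_distr[OF cm[OF z] B] \<kappa>_sp[OF z] Q_def c_def
            intro!: nn_integral_cong arg_cong[where f="emeasure _"])
      finally show ?thesis .
    next
      case False
      have "emeasure (\<kappa> False z \<Otimes>\<^sub>M \<kappa> True z) Q = (\<integral>\<^sup>+x. emeasure (\<kappa> True z) (Pair x -` Q) \<partial>\<kappa> False z)"
        by (rule T.emeasure_pair_measure_alt[OF Q])
      also have "\<dots> = (\<integral>\<^sup>+x. emeasure (G a z x) B \<partial>\<kappa> a z)"
        unfolding G_def using False
        by (auto simp: emeasure_distr[OF cm[OF z] B] \<kappa>_sp[OF z] Q_def c_def
            intro!: nn_integral_cong arg_cong[where f="emeasure _"])
      finally show ?thesis .
    qed
    also have "\<dots> = emeasure (\<kappa> a z \<bind> G a z) B"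
      by (rule emeasure_bind_prob_algebra[OF \<kappa>_space Gx B, symmetric])
    finally show "emeasure (\<kappa> a z \<bind> G a z) B = emeasure (k z) B" ..
  qed
  have K'm[measurable]: "K' \<in> MX \<Otimes>\<^sub>M count_space UNIV \<rightarrow>\<^sub>M prob_algebra MZ'"
    by (rule representationD[OF K'])
  have law_J: "law_given a M X A MZ K = distr (J a) MZ fst" for a
  proof -
    have "law_given a M X A MZ K = \<nu> a \<bind> (\<lambda>\<omega>. K (X \<omega>, a))"
      unfolding law_given_eq_bind[OF M X A K] \<nu>_def[symmetric]
      \<comment> \<open>Under \<open>\<nu> a\<close> the variable \<open>A\<close> is almost surely
        \<open>a\<close>, so the kernel may be evaluated at the constant \<open>a\<close>.\<close>
      using \<nu>_AE[of a] by (intro bind_cong_AE'[OF \<nu>_space]) (measurable, auto)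
    also have "\<dots> = \<nu> a \<bind> (\<lambda>\<omega>. distr (distr (K (X \<omega>, a)) (MZ \<Otimes>\<^sub>M MX) (\<lambda>z. (z, X \<omega>))) MZ fst)"
    proof (rule bind_cong[OF refl])
      fix \<omega> assume "\<omega> \<in> space (\<nu> a)"
      then have x[measurable]: "X \<omega> \<in> space MX"
        using measurable_space[OF X] by (simp add: \<nu>_def)
      note [measurable_cong] = representationD(3)[OF K x]
      show "K (X \<omega>, a) = distr (distr (K (X \<omega>, a)) (MZ \<Otimes>\<^sub>M MX) (\<lambda>z. (z, X \<omega>))) MZ fst"
        by (subst distr_distr) (simp_all add: comp_def distr_id2 representationD(3)[OF K x])
    qed
    also have "\<dots> = distr (J a) MZ fst"
      unfolding J_def by (rule distr_bind[symmetric, OF _ \<nu>_ne]) measurable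
    finally show ?thesis .
  qed
  \<comment> \<open>The pair \<open>(Z, X)\<close> is first drawn jointly from \<open>J a\<close>,
    then redrawn as \<open>Z\<close> followed by \<open>X\<close> through \<open>J_eq\<close>; after
    regrouping, \<open>couple\<close> turns the inner stage into \<open>k\<close>.\<close>
  have law: "law_given a M X A MZ' K' = law_given a M X A MZ K \<bind> k" for a
  proof -
    have "law_given a M X A MZ' K' = \<nu> a \<bind> (\<lambda>\<omega>. K' (X \<omega>, a))"
      unfolding law_given_eq_bind[OF M X A K'] \<nu>_def[symmetric]
      using \<nu>_AE[of a] by (intro bind_cong_AE'[OF \<nu>_space]) (measurable, auto)
    also have "\<dots> = \<nu> a \<bind> (\<lambda>\<omega>. distr (K (X \<omega>, a)) (MZ \<Otimes>\<^sub>M MX) (\<lambda>z. (z, X \<omega>)) \<bind> (\<lambda>(z, x). G a z x))"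
    proof (rule bind_cong[OF refl])
      fix \<omega> assume "\<omega> \<in> space (\<nu> a)"
      then have x[measurable]: "X \<omega> \<in> space MX"
        using measurable_space[OF X] by (simp add: \<nu>_def)
      note [measurable_cong] = representationD(3)[OF K x]
      show "K' (X \<omega>, a) = distr (K (X \<omega>, a)) (MZ \<Otimes>\<^sub>M MX) (\<lambda>z. (z, X \<omega>)) \<bind> (\<lambda>(z, x). G a z x)"
        by (subst bind_distr[where K=MZ'])
          (measurable, auto simp: K'_def intro!: prob_space.not_empty[OF representationD(2)[OF K x]])
    qed
    also have "\<dots> = J a \<bind> (\<lambda>(z, x). G a z x)"
      unfolding J_def by (rule bind_assoc[symmetric, where N="MZ \<Otimes>\<^sub>M MX" and R=MZ']) measurable
    also have "\<dots> = distr (J a) MZ fst \<bind> (\<lambda>z. distr (\<kappa> a z) (MZ \<Otimes>\<^sub>M MX) (\<lambda>x. (z, x))) \<bind> (\<lambda>(z, x). G a z x)"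
      using J_eq[of a] by simp
    also have "\<dots> = distr (J a) MZ fst \<bind> (\<lambda>z. distr (\<kappa> a z) (MZ \<Otimes>\<^sub>M MX) (\<lambda>x. (z, x)) \<bind> (\<lambda>(z, x). G a z x))"
      by (rule bind_assoc[where N="MZ \<Otimes>\<^sub>M MX" and R=MZ']; rule measurable_prob_algebraD) measurable
    also have "\<dots> = distr (J a) MZ fst \<bind> k"
    proof (rule bind_cong[OF refl])
      fix z assume "z \<in> space (distr (J a) MZ fst)"
      then have z[measurable]: "z \<in> space MZ" by simp
      note [measurable_cong] = \<kappa>_sets[OF z]
      have "distr (\<kappa> a z) (MZ \<Otimes>\<^sub>M MX) (\<lambda>x. (z, x)) \<bind> (\<lambda>(z, x). G a z x) = \<kappa> a z \<bind> G a z"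
        by (subst bind_distr[where K=MZ'])
          (measurable, auto intro!: prob_space.not_empty[OF \<kappa>_prob[OF z]])
      then show "distr (\<kappa> a z) (MZ \<Otimes>\<^sub>M MX) (\<lambda>x. (z, x)) \<bind> (\<lambda>(z, x). G a z x) = k z"
        by (simp add: couple[OF z])
    qed
    finally show ?thesis by (simp add: law_J)
  qed
  show ?thesis
    using K' inv D' expected_h_refine[OF M X A Y h K K' \<phi> KK'] D_TV_refine[OF M X A pos K K' k \<phi> section_k law]
    by blast
qed

theorem theorem3p1:
  fixes M :: "'m measure" and MX :: "'x measure" and MZ :: "'z measure"
    and X :: "'m \<Rightarrow> 'x" and A :: "'m \<Rightarrow> bool" and Y :: "'m \<Rightarrow> 'y::finite"
    and h :: "real ^ 'y \<Rightarrow> real" and K :: "'x \<times> bool \<Rightarrow> 'z measure"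
  assumes "prob_space M"
    and "X \<in> M \<rightarrow>\<^sub>M MX" and "A \<in> M \<rightarrow>\<^sub>M count_space UNIV" and "Y \<in> M \<rightarrow>\<^sub>M count_space UNIV"
    and "\<And>a. measure M {\<omega> \<in> space M. A \<omega> = a} > 0"
    and "continuous_on prob_simplex h" and "concave_on prob_simplex h"
    and "representation MX MZ K"
  shows "\<exists>(MZ' :: ('z \<times> 'x \<times> 'x \<times> real) measure) K'.
    representation MX MZ' K' \<and> invertible_rep MX MZ' K' \<and>
    (discrete_space MX \<and> discrete_space MZ \<longrightarrow> discrete_space MZ') \<and>
    expected_h h M X A Y MZ' K' \<le> expected_h h M X A Y MZ K \<and>
    D_TV M X A MZ' K' = D_TV M X A MZ K"
proof (cases "discrete_space MX \<and> discrete_space MZ")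
  case True
  then show ?thesis using refine_by_coupling[OF assms] by blast
next
  case False
  \<comment> \<open>The discreteness clause holds vacuously in this case, so nondiscrete extra
    randomness is allowed.\<close>
  then show ?thesis using refine_by_uniform[OF assms] by blast
qed

end
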